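(* Let $k\ge0$ and let $A\langle k\rangle_*=A_*/(\xi_{k+1},\xi_{k+2},\dots)\cong\mathbb F_2[\xi_1,\dots,\xi_k]$. For any $m\ge 0$, the sequence of (images of) elements $$\zeta_{m+1},\zeta_{m+2},\dots,\zeta_{m+k}$$ is regular in $A\langle k\rangle_*$, and all higher $\zeta_i$ (that is, $i>m+k$) are in the ideal of $A\langle k\rangle_*$ generated by them. Consequently, $A\langle k\rangle_*/(\zeta_{m+1},\dots,\zeta_{m+k})$ is a commutative graded Frobenius algebra over $\mathbb F_2$ with top class in degree $2^{m+k+1}-2^{m+1}-2^{k+1}+2$.
   Context: $A_*=\mathbb F_2[\xi_1,\xi_2,\dots]$ is the dual Steenrod algebra, graded with $|\xi_i|=2^i-1$, $\xi_0=1$. The conjugates $\zeta_i\in A_*$ are determined by $\zeta_0=1$ and Milnor's formula $\sum_{i+j=n}\xi_i^{2^j}\zeta_j=0$ for $n\ge1$. A commutative graded $\mathbb F_2$-algebra $R$ is a graded Frobenius algebra with top class in degree $\delta$ if it is finite-dimensional, $R_\delta$ is one-dimensional and is the top nonzero degree, and for every $t$ the multiplication $R_t\otimes R_{\delta-t}\to R_\delta\cong\mathbb F_2$ is a perfect pairing. *)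

theory Defs
  imports "HOL-Algebra.QuotRing" "HOL-Library.Poly_Mapping" "HOL-Library.Z2"
    "Jordan_Normal_Form.VS_Connect"
begin

section \<open>Commutative algebra\<close>

text \<open>The quotient algebra \<open>A / I\<close>: the library's factor ring together with the induced scalar
  multiplication \<open>c (I + x) = I + c x\<close>, written on cosets in the same style as
  \<^const>\<open>rcoset_mult\<close>.\<close>

definition quot_algebra :: "('k, 'a) module \<Rightarrow> 'a set \<Rightarrow> ('k, 'a set) module" where
  "quot_algebra A I =
    \<lparr>carrier = carrier (A Quot I), mult = mult (A Quot I), one = one (A Quot I),
     zero = zero (A Quot I), add = add (A Quot I),
     smult = (\<lambda>c X. \<Union>x\<in>X. I +>\<^bsub>A\<^esub> (c \<odot>\<^bsub>A\<^esub> x))\<rparr>"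

definition quot_grading :: "('k, 'a) module \<Rightarrow> (int \<Rightarrow> 'a set) \<Rightarrow> 'a set \<Rightarrow> int \<Rightarrow> 'a set set" where
  "quot_grading A gr I t = (\<lambda>x. I +>\<^bsub>A\<^esub> x) ` gr t"

definition regular_sequence :: "('a, 'b) ring_scheme \<Rightarrow> 'a list \<Rightarrow> bool" where
  "regular_sequence R xs \<longleftrightarrow>
     set xs \<subseteq> carrier R \<and>
     (\<forall>i<length xs. let I = Idl\<^bsub>R\<^esub> (set (take i xs)) in
        \<forall>Y\<in>carrier (R Quot I).
          (I +>\<^bsub>R\<^esub> xs ! i) \<otimes>\<^bsub>R Quot I\<^esub> Y = \<zero>\<^bsub>R Quot I\<^esub> \<longrightarrow> Y = \<zero>\<^bsub>R Quot I\<^esub>) \<and>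
     Idl\<^bsub>R\<^esub> (set xs) \<noteq> carrier R"

text \<open>Gradings are indexed by \<^typ>\<open>int\<close>, so that the degree \<open>\<delta> - t\<close> is not truncated for
  \<open>t > \<delta>\<close>.  The last condition says that the algebra is the direct sum of the \<open>gr t\<close>.\<close>

definition graded_algebra :: "'k ring \<Rightarrow> ('k, 'a) module \<Rightarrow> (int \<Rightarrow> 'a set) \<Rightarrow> bool" where
  "graded_algebra K R gr \<longleftrightarrow>
     algebra K R \<and>
     (\<forall>t. VectorSpace.subspace K (gr t) R) \<and>
     \<one>\<^bsub>R\<^esub> \<in> gr 0 \<and>
     (\<forall>s t. \<forall>x\<in>gr s. \<forall>y\<in>gr t. x \<otimes>\<^bsub>R\<^esub> y \<in> gr (s + t)) \<and>
     (\<forall>x\<in>carrier R. \<exists>!c. (\<forall>t. c t \<in> gr t) \<and> finite {t. c t \<noteq> \<zero>\<^bsub>R\<^esub>} \<and>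
        x = finsum R c {t. c t \<noteq> \<zero>\<^bsub>R\<^esub>})"

text \<open>A bilinear map \<open>\<beta> : V \<times> W \<rightarrow> L\<close> into a one-dimensional space \<open>L\<close> is a perfect pairing if
  both adjoint maps \<open>V \<rightarrow> Hom(W, L)\<close> and \<open>W \<rightarrow> Hom(V, L)\<close> are bijective.  Elements of
  \<^const>\<open>LinearCombinations.module_hom\<close> are arbitrary outside the carrier, hence the restriction to extensional
  functions.\<close>

definition perfect_pairing ::
  "'k ring \<Rightarrow> ('k, 'a) module \<Rightarrow> ('k, 'b) module \<Rightarrow> ('k, 'c) module \<Rightarrow> ('a \<Rightarrow> 'b \<Rightarrow> 'c) \<Rightarrow> bool" where
  "perfect_pairing K V W L \<beta> \<longleftrightarrow>
     (\<forall>v\<in>carrier V. \<beta> v \<in> LinearCombinations.module_hom K W L) \<and>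
     (\<forall>w\<in>carrier W. (\<lambda>v. \<beta> v w) \<in> LinearCombinations.module_hom K V L) \<and>
     bij_betw (\<lambda>v. restrict (\<beta> v) (carrier W))
       (carrier V) (LinearCombinations.module_hom K W L \<inter> extensional (carrier W)) \<and>
     bij_betw (\<lambda>w. restrict (\<lambda>v. \<beta> v w) (carrier V))
       (carrier W) (LinearCombinations.module_hom K V L \<inter> extensional (carrier V))"

definition graded_frobenius_algebra ::
  "'k ring \<Rightarrow> ('k, 'a) module \<Rightarrow> (int \<Rightarrow> 'a set) \<Rightarrow> int \<Rightarrow> bool" where
  "graded_frobenius_algebra K R gr \<delta> \<longleftrightarrow>
     graded_algebra K R gr \<and>
     vectorspace.fin_dim K R \<and>
     vectorspace.dim K (R\<lparr>carrier := gr \<delta>\<rparr>) = 1 \<and>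
     (\<forall>t>\<delta>. gr t = {\<zero>\<^bsub>R\<^esub>}) \<and>
     (\<forall>t. perfect_pairing K (R\<lparr>carrier := gr t\<rparr>) (R\<lparr>carrier := gr (\<delta> - t)\<rparr>)
            (R\<lparr>carrier := gr \<delta>\<rparr>) (\<lambda>x y. x \<otimes>\<^bsub>R\<^esub> y))"


section \<open>The dual Steenrod algebra\<close>

text \<open>Elements of \<open>\<F>\<^sub>2[\<xi>\<^sub>1, \<xi>\<^sub>2, \<dots>]\<close> are finitely supported maps from monomials to \<^typ>\<open>bit\<close>, and a
  monomial is a finitely supported exponent map.  The exponent of \<open>\<xi>\<^sub>i\<close> (\<open>i \<ge> 1\<close>) is stored at
  index \<open>i - 1\<close>.\<close>

type_synonym steenrod = "(nat \<Rightarrow>\<^sub>0 nat) \<Rightarrow>\<^sub>0 bit"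

definition steenrod_dual :: "(bit, steenrod) module" where
  "steenrod_dual =
    \<lparr>carrier = UNIV, mult = (*), one = 1, zero = 0, add = (+),
     smult = (\<lambda>c. Poly_Mapping.map ((*) c))\<rparr>"

fun xi :: "nat \<Rightarrow> steenrod" where
  "xi 0 = 1"
| "xi (Suc i) = Poly_Mapping.single (Poly_Mapping.single i 1) 1"

text \<open>The degree of a monomial, with \<open>|\<xi>\<^sub>i| = 2\<^sup>i - 1\<close>.\<close>

definition mon_degree :: "(nat \<Rightarrow>\<^sub>0 nat) \<Rightarrow> nat" where
  "mon_degree \<mu> = (\<Sum>i\<in>Poly_Mapping.keys \<mu>. Poly_Mapping.lookup \<mu> i * (2 ^ Suc i - 1))"

definition steenrod_grading :: "int \<Rightarrow> steenrod set" where
  "steenrod_grading t = {f. \<forall>\<mu>\<in>Poly_Mapping.keys f. int (mon_degree \<mu>) = t}"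

text \<open>Milnor's formula solved for \<open>\<zeta>\<^sub>n\<close>, which is its summand with \<open>i = 0\<close>.\<close>

fun zeta :: "nat \<Rightarrow> steenrod" where
  "zeta 0 = 1"
| "zeta (Suc n) = - (\<Sum>j\<le>n. xi (Suc n - j) ^ 2 ^ j * zeta j)"

lemma milnor_formula:
  assumes "n \<ge> 1"
  shows "(\<Sum>(i, j)\<in>{(i, j). i + j = n}. xi i ^ 2 ^ j * zeta j) = 0"
proof -
  obtain n' where n: "n = Suc n'"
    using assms by (cases n) auto
  have "(\<Sum>(i, j)\<in>{(i, j). i + j = n}. xi i ^ 2 ^ j * zeta j)
      = (\<Sum>j\<le>n. xi (n - j) ^ 2 ^ j * zeta j)"
    by (rule sum.reindex_bij_witness[of _ "\<lambda>j. (n - j, j)" snd]) auto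
  also have "\<dots> = 0"
    by (simp add: n)
  finally show ?thesis .
qed

text \<open>\<open>A\<langle>k\<rangle>\<^sub>* = A\<^sub>* / (\<xi>\<^sub>k\<^sub>+\<^sub>1, \<xi>\<^sub>k\<^sub>+\<^sub>2, \<dots>)\<close> with its induced grading, and the subalgebra
  \<open>\<F>\<^sub>2[\<xi>\<^sub>1, \<dots>, \<xi>\<^sub>k]\<close> of \<open>A\<^sub>*\<close>.\<close>

definition xi_ideal :: "nat \<Rightarrow> steenrod set" where
  "xi_ideal k = Idl\<^bsub>steenrod_dual\<^esub> (xi ` {k<..})"

definition steenrod_trunc :: "nat \<Rightarrow> (bit, steenrod set) module" where
  "steenrod_trunc k = quot_algebra steenrod_dual (xi_ideal k)"

definition steenrod_trunc_grading :: "nat \<Rightarrow> int \<Rightarrow> steenrod set set" where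
  "steenrod_trunc_grading k = quot_grading steenrod_dual steenrod_grading (xi_ideal k)"

definition trunc_proj :: "nat \<Rightarrow> steenrod \<Rightarrow> steenrod set" where
  "trunc_proj k f = xi_ideal k +>\<^bsub>steenrod_dual\<^esub> f"

definition xi_polys :: "nat \<Rightarrow> (bit, steenrod) module" where
  "xi_polys k = steenrod_dual
     \<lparr>carrier := {f. \<forall>\<mu>\<in>Poly_Mapping.keys f. Poly_Mapping.keys \<mu> \<subseteq> {..<k}}\<rparr>"

definition zeta_seq :: "nat \<Rightarrow> nat \<Rightarrow> steenrod set list" where
  "zeta_seq k m = map (\<lambda>i. trunc_proj k (zeta i)) [m + 1..<m + k + 1]"

definition zeta_ideal :: "nat \<Rightarrow> nat \<Rightarrow> steenrod set set" where
  "zeta_ideal k m = Idl\<^bsub>steenrod_trunc k\<^esub> (set (zeta_seq k m))"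

end

theory Submission
  imports Defs
begin

text \<open>
  Let \<open>L\<close> be the ideal of \<open>\<F>\<^sub>2[\<xi>\<^sub>1, \<dots>, \<xi>\<^sub>k]\<close> generated by \<open>\<zeta>\<^sub>m\<^sub>+\<^sub>1, \<dots>, \<zeta>\<^sub>m\<^sub>+\<^sub>k\<^sub>-\<^sub>1\<close>. Milnor's formula gives
  \<open>\<zeta>\<^sub>m\<^sub>+\<^sub>k = \<xi>\<^sub>k^(2^m) \<zeta>\<^sub>m\<close> modulo \<open>L\<close>. The ideal \<open>L + (\<xi>\<^sub>k)\<close> belongs to the pair \<open>(k - 1, m)\<close>, and
  \<open>L + (\<zeta>\<^sub>m)\<close> to the pair \<open>(k, m - 1)\<close>. Homogeneous regular sequences of positive degree may be
  permuted, so by induction \<open>\<xi>\<^sub>k\<close> and \<open>\<zeta>\<^sub>m\<close>, and hence \<open>\<zeta>\<^sub>m\<^sub>+\<^sub>k\<close>, are regular modulo \<open>L\<close>.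

  If \<open>a\<close> and \<open>b\<close> are regular modulo \<open>L\<close> and \<open>a\<close> has positive degree, multiplication by \<open>b\<close> maps the
  socle modulo \<open>L + (a)\<close> isomorphically onto the socle modulo \<open>L + (a b)\<close>. With \<open>a = \<zeta>\<^sub>m\<close> and
  \<open>b = \<xi>\<^sub>k^(2^m)\<close>, induction on \<open>m\<close> shows that the socle of the quotient is one-dimensional and gives its
  degree. Every nonzero homogeneous element of a finite-dimensional graded algebra has a multiple in
  the socle, which makes the multiplication pairings nondegenerate.
\<close>

section \<open>Polynomials over the field with two elements\<close>

text \<open>A commutative ring acts on itself by multiplication, and the submodules for this action
  are the ideals. So \<open>idl.span G\<close> is the ideal generated by G, and the span calculus
  applies to ideal membership.\<close>

interpretation idl: Modules.module "(*) :: 'a::comm_ring_1 \<Rightarrow> 'a \<Rightarrow> 'a"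
  by unfold_locales (simp_all add: algebra_simps)

declare idl.scale_scale [simp del] \<comment> \<open>loops together with \<open>mult.left_commute\<close>\<close>

lemma idl_mult_left: "x \<in> idl.span S \<Longrightarrow> c * x \<in> idl.span S"
  by (rule idl.span_scale)

lemma idl_mult_right: "x \<in> idl.span S \<Longrightarrow> x * c \<in> idl.span S"
  using idl.span_scale[of x S c] by (simp add: mult.commute)

text \<open>Two filters recur: the monomials of a fixed degree, which cut out homogeneous
  components, and the monomials without any xi_i for i > k, which give normal forms in A<k>.\<close>

definition restr :: "('a \<Rightarrow> bool) \<Rightarrow> ('a \<Rightarrow>\<^sub>0 'b::zero) \<Rightarrow> 'a \<Rightarrow>\<^sub>0 'b" where
  "restr P f = Poly_Mapping.mapp (\<lambda>\<mu> c. c when P \<mu>) f"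

lemma lookup_restr: "Poly_Mapping.lookup (restr P f) \<mu> = (if P \<mu> then Poly_Mapping.lookup f \<mu> else 0)"
  by (auto simp: restr_def lookup_mapp when_def in_keys_iff)

lemma keys_restr: "Poly_Mapping.keys (restr P f) = {\<mu> \<in> Poly_Mapping.keys f. P \<mu>}"
  by (auto simp: in_keys_iff lookup_restr split: if_splits)

lemma restr_zero [simp]: "restr P 0 = 0"
  by (rule poly_mapping_eqI) (simp add: lookup_restr)

lemma restr_add: "restr P (f + g) = restr P f + restr P (g :: 'a \<Rightarrow>\<^sub>0 'b::monoid_add)"
  by (rule poly_mapping_eqI) (simp add: lookup_restr lookup_add)

lemma restr_diff: "restr P (f - g) = restr P f - restr P (g :: 'a \<Rightarrow>\<^sub>0 'b::ab_group_add)"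
  by (rule poly_mapping_eqI) (simp add: lookup_restr lookup_minus)

lemma restr_sum: "restr P (\<Sum>i\<in>A. f i) = (\<Sum>i\<in>A. restr P (f i :: 'a \<Rightarrow>\<^sub>0 'b::comm_monoid_add))"
  by (induction A rule: infinite_finite_induct) (simp_all add: restr_add)

lemma restr_split: "f = restr P f + restr (\<lambda>\<mu>. \<not> P \<mu>) (f :: 'a \<Rightarrow>\<^sub>0 'b::monoid_add)"
  by (rule poly_mapping_eqI) (simp add: lookup_restr lookup_add)

lemma restr_id: "(\<And>\<mu>. \<mu> \<in> Poly_Mapping.keys f \<Longrightarrow> P \<mu>) \<Longrightarrow> restr P f = f"
  by (rule poly_mapping_eqI) (auto simp: lookup_restr in_keys_iff)

lemma restr_restr: "restr P (restr P f) = restr P f"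
  by (rule restr_id) (simp add: keys_restr)

lemma restr_eq_0_iff: "restr P f = 0 \<longleftrightarrow> (\<forall>\<mu>\<in>Poly_Mapping.keys f. \<not> P \<mu>)"
  by (auto simp: poly_mapping_eq_iff fun_eq_iff lookup_restr in_keys_iff)

text \<open>Split f according to Q. Multiplication by g sends every monomial of the first part to
  monomials satisfying P, and those of the second part to monomials violating P.\<close>

lemma restr_mult:
  fixes f g :: "'a::monoid_add \<Rightarrow>\<^sub>0 'b::comm_ring_1"
  assumes "\<And>\<nu> \<mu>. \<nu> \<in> Poly_Mapping.keys g \<Longrightarrow> P (\<nu> + \<mu>) \<longleftrightarrow> Q \<mu>"
  shows "restr P (g * f) = g * restr Q f"
proof -
  have "restr P (g * f) = restr P (g * restr Q f) + restr P (g * restr (\<lambda>\<mu>. \<not> Q \<mu>) f)"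
    by (subst restr_split[of f Q]) (simp only: distrib_left restr_add)
  also have "restr P (g * restr Q f) = g * restr Q f"
    using keys_mult[of g "restr Q f"] assms by (intro restr_id) (auto simp: keys_restr)
  also have "restr P (g * restr (\<lambda>\<mu>. \<not> Q \<mu>) f) = 0"
    using keys_mult[of g "restr (\<lambda>\<mu>. \<not> Q \<mu>) f"] assms
    by (auto simp: restr_eq_0_iff keys_restr)
  finally show ?thesis by simp
qed

section \<open>Monomials, degrees and homogeneous components\<close>

abbreviation xmon :: "(nat \<Rightarrow>\<^sub>0 nat) \<Rightarrow> steenrod" where
  "xmon \<mu> \<equiv> Poly_Mapping.single \<mu> 1"

lemma xmon_mult: "xmon \<mu> * xmon \<nu> = xmon (\<mu> + \<nu>)"
  by (simp add: mult_single)

lemma steenrod_sum_xmon: "f = (\<Sum>\<mu>\<in>Poly_Mapping.keys f. xmon \<mu>)" for f :: steenrod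
proof (rule poly_mapping_eqI)
  fix \<nu>
  have "(\<Sum>\<mu>\<in>Poly_Mapping.keys f. Poly_Mapping.lookup (xmon \<mu>) \<nu>) = (\<Sum>\<mu>\<in>Poly_Mapping.keys f. if \<mu> = \<nu> then 1 else 0)"
    by (rule sum.cong) (auto simp: lookup_single when_def)
  then show "Poly_Mapping.lookup f \<nu> = Poly_Mapping.lookup (\<Sum>\<mu>\<in>Poly_Mapping.keys f. xmon \<mu>) \<nu>"
    by (auto simp: lookup_sum in_keys_iff bit_not_zero_iff)
qed

lemma steenrod_add_self: "f + f = 0" for f :: steenrod
  by (rule poly_mapping_eqI) (simp only: lookup_add lookup_zero, simp)

lemma steenrod_uminus: "- f = f" for f :: steenrod
  by (rule poly_mapping_eqI) simp

lemma xi_eq_xmon: "i \<ge> 1 \<Longrightarrow> xi i = xmon (Poly_Mapping.single (i - 1) 1)"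
  by (cases i) auto

lemma mon_degree_eq_sum:
  assumes "finite A" "Poly_Mapping.keys \<mu> \<subseteq> A"
  shows "mon_degree \<mu> = (\<Sum>i\<in>A. Poly_Mapping.lookup \<mu> i * (2 ^ Suc i - 1))"
  unfolding mon_degree_def
  by (rule sum.mono_neutral_left) (use assms in \<open>auto simp: in_keys_iff\<close>)

lemma mon_degree_add: "mon_degree (\<mu> + \<nu>) = mon_degree \<mu> + mon_degree \<nu>"
proof -
  let ?A = "Poly_Mapping.keys \<mu> \<union> Poly_Mapping.keys \<nu>"
  have "finite ?A" "Poly_Mapping.keys (\<mu> + \<nu>) \<subseteq> ?A"
    using keys_add[of \<mu> \<nu>] by auto
  then show ?thesis
    by (simp add: mon_degree_eq_sum[where A = ?A] lookup_add add_mult_distrib sum.distrib)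
qed

lemma mon_degree_single: "mon_degree (Poly_Mapping.single i n) = n * (2 ^ Suc i - 1)"
  by (simp add: mon_degree_def)

lemma mon_degree_0 [simp]: "mon_degree 0 = 0"
  by (simp add: mon_degree_def)

lemma mon_degree_eq_0_iff: "mon_degree \<mu> = 0 \<longleftrightarrow> \<mu> = 0"
proof -
  have "(2::nat) ^ Suc i - 1 \<noteq> 0" for i
    using one_less_power[of "2::nat" "Suc i"] by simp
  then have "mon_degree \<mu> = 0 \<longleftrightarrow> (\<forall>i\<in>Poly_Mapping.keys \<mu>. Poly_Mapping.lookup \<mu> i = 0)"
    unfolding mon_degree_def by (simp only: sum_eq_0_iff finite_keys mult_eq_0_iff simp_thms)
  then show ?thesis
    by (metis in_keys_iff keys_eq_empty ex_in_conv lookup_zero)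
qed

abbreviation hcomp :: "int \<Rightarrow> steenrod \<Rightarrow> steenrod" where
  "hcomp t \<equiv> restr (\<lambda>\<mu>. int (mon_degree \<mu>) = t)"

lemma hcomp_in_grading: "hcomp t f \<in> steenrod_grading t"
  by (simp add: steenrod_grading_def keys_restr)

lemma hcomp_grading: "f \<in> steenrod_grading s \<Longrightarrow> hcomp t f = (if s = t then f else 0)"
  by (auto simp: steenrod_grading_def restr_eq_0_iff intro!: restr_id)

lemma hcomp_mult: "g \<in> steenrod_grading s \<Longrightarrow> hcomp t (g * f) = g * hcomp (t - s) f"
  by (rule restr_mult) (auto simp: steenrod_grading_def mon_degree_add)

lemma steenrod_sum_hcomp:
  assumes "finite T" "(\<lambda>\<mu>. int (mon_degree \<mu>)) ` Poly_Mapping.keys f \<subseteq> T"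
  shows "(\<Sum>t\<in>T. hcomp t f) = f"
proof (rule poly_mapping_eqI)
  fix \<mu>
  have "(\<Sum>t\<in>T. Poly_Mapping.lookup (hcomp t f) \<mu>)
      = (\<Sum>t\<in>T. if t = int (mon_degree \<mu>) then Poly_Mapping.lookup f \<mu> else 0)"
    by (rule sum.cong) (auto simp: lookup_restr)
  then show "Poly_Mapping.lookup (\<Sum>t\<in>T. hcomp t f) \<mu> = Poly_Mapping.lookup f \<mu>"
    using assms by (auto simp: lookup_sum in_keys_iff image_subset_iff)
qed

lemma grading_zero [simp]: "0 \<in> steenrod_grading t"
  by (simp add: steenrod_grading_def)

lemma grading_one: "1 \<in> steenrod_grading 0"
  by (simp add: steenrod_grading_def)

lemma grading_add: "f \<in> steenrod_grading t \<Longrightarrow> g \<in> steenrod_grading t \<Longrightarrow> f + g \<in> steenrod_grading t"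
  using keys_add[of f g] by (fastforce simp: steenrod_grading_def)

lemma grading_sum: "(\<And>i. i \<in> A \<Longrightarrow> f i \<in> steenrod_grading t) \<Longrightarrow> (\<Sum>i\<in>A. f i) \<in> steenrod_grading t"
  by (induction A rule: infinite_finite_induct) (auto intro: grading_add)

lemma grading_mult: "f \<in> steenrod_grading s \<Longrightarrow> g \<in> steenrod_grading t \<Longrightarrow> f * g \<in> steenrod_grading (s + t)"
  using keys_mult[of f g] by (fastforce simp: steenrod_grading_def mon_degree_add)

lemma grading_power: "f \<in> steenrod_grading s \<Longrightarrow> f ^ n \<in> steenrod_grading (int n * s)"
proof (induction n)
  case (Suc n)
  from grading_mult[OF Suc.prems Suc.IH[OF Suc.prems]] show ?case
    by (simp add: algebra_simps)
qed (simp add: grading_one)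

lemma grading_xmon: "xmon \<mu> \<in> steenrod_grading (int (mon_degree \<mu>))"
  by (simp add: steenrod_grading_def)

lemma grading_xi: "xi i \<in> steenrod_grading (2 ^ i - 1)"
  by (cases i) (auto simp: steenrod_grading_def mon_degree_single of_nat_diff)

lemma grading_zeta: "zeta n \<in> steenrod_grading (2 ^ n - 1)"
proof (induction n rule: less_induct)
  case (less n)
  show ?case
  proof (cases n)
    case 0
    then show ?thesis by (simp add: grading_one)
  next
    case (Suc n')
    have "xi (n - j) ^ 2 ^ j * zeta j \<in> steenrod_grading (2 ^ n - 1)" if "j \<le> n'" for j
    proof -
      have "xi (n - j) ^ 2 ^ j * zeta j \<in> steenrod_grading (int (2 ^ j) * (2 ^ (n - j) - 1) + (2 ^ j - 1))"
        using that Suc by (intro grading_mult grading_power grading_xi less) auto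
      also have "int (2 ^ j) * (2 ^ (n - j) - 1) + (2 ^ j - 1) = 2 ^ n - 1"
        using that Suc by (simp add: algebra_simps flip: power_add)
      finally show ?thesis .
    qed
    then have "(\<Sum>j\<le>n'. xi (n - j) ^ 2 ^ j * zeta j) \<in> steenrod_grading (2 ^ n - 1)"
      by (intro grading_sum) auto
    then show ?thesis
      by (simp add: Suc steenrod_uminus)
  qed
qed

text \<open>The generators may have different degrees. Requiring each degree to be positive keeps
  the generated ideal inside the augmentation ideal, hence proper.\<close>

definition homogeneous :: "steenrod set \<Rightarrow> bool" where
  "homogeneous G \<longleftrightarrow> (\<forall>g\<in>G. \<exists>t>0. g \<in> steenrod_grading t)"

lemma hcomp_in_span:
  assumes "homogeneous G" "f \<in> idl.span G"
  shows "hcomp t f \<in> idl.span G"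
  using assms(2)
proof (induction rule: idl.span_induct_alt)
  case base
  then show ?case by (simp add: idl.span_zero)
next
  case (step c g f)
  obtain s where "g \<in> steenrod_grading s"
    using assms(1) step by (auto simp: homogeneous_def)
  then have "hcomp t (c * g + f) = g * hcomp (t - s) c + hcomp t f"
    using hcomp_mult[of g s t c] by (simp add: restr_add mult.commute)
  then show ?case
    using step idl.span_base[OF step(1)] by (auto intro!: idl.span_add idl_mult_right)
qed

text \<open>The degree t component of a multiple of a generator of degree s is the generator times a
  component of degree t - s < 0, and no monomial has negative degree.\<close>

lemma hcomp_0_span:
  assumes "homogeneous G" "f \<in> idl.span G" "t \<le> 0"
  shows "hcomp t f = 0"
  using assms(2)
proof (induction rule: idl.span_induct_alt)
  case (step c g f)
  obtain s where s: "g \<in> steenrod_grading s" "s > 0"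
    using assms(1) step by (auto simp: homogeneous_def)
  then have "hcomp (t - s) c = 0"
    using assms(3) by (auto simp: restr_eq_0_iff)
  then show ?case
    using hcomp_mult[of g s t c] s step by (simp add: restr_add mult.commute)
qed simp

lemma one_notin_span:
  assumes "homogeneous G"
  shows "1 \<notin> idl.span G"
  using hcomp_0_span[OF assms, of 1 0] hcomp_grading[OF grading_one, of 0] by auto

lemma span_homogeneousI:
  assumes "\<And>t. hcomp t f \<in> idl.span G"
  shows "f \<in> idl.span G"
proof -
  have "(\<Sum>t\<in>(\<lambda>\<mu>. int (mon_degree \<mu>)) ` Poly_Mapping.keys f. hcomp t f) \<in> idl.span G"
    using assms by (intro idl.span_sum) auto
  then show ?thesis
    by (subst (asm) steenrod_sum_hcomp) auto
qed

text \<open>This is a monomial ideal, so membership is tested on each monomial separately. As xi_i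
  sits at index i - 1, the indices at least k belong to the generators xi_{k+1}, xi_{k+2}, and so
  on.\<close>

lemma xi_ideal_span_iff:
  "f \<in> idl.span (xi ` {k<..}) \<longleftrightarrow> restr (\<lambda>\<mu>. Poly_Mapping.keys \<mu> \<subseteq> {..<k}) f = 0"
proof
  assume "f \<in> idl.span (xi ` {k<..})"
  then show "restr (\<lambda>\<mu>. Poly_Mapping.keys \<mu> \<subseteq> {..<k}) f = 0"
  proof (induction rule: idl.span_induct_alt)
    case (step c g f)
    from step(1) obtain i where i: "i > k" "g = xi i" by auto
    have keys_in: "j \<in> Poly_Mapping.keys (\<nu> + Poly_Mapping.single j (1::nat))" for j and \<nu> :: "nat \<Rightarrow>\<^sub>0 nat"
      by (simp add: in_keys_iff lookup_add)
    have "restr (\<lambda>\<mu>. Poly_Mapping.keys \<mu> \<subseteq> {..<k}) (c * g) = 0"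
      using keys_mult[of c g] keys_in[of "i - 1"] i
      by (fastforce simp: restr_eq_0_iff xi_eq_xmon)
    with step show ?case by (simp add: restr_add)
  qed simp
next
  assume *: "restr (\<lambda>\<mu>. Poly_Mapping.keys \<mu> \<subseteq> {..<k}) f = 0"
  have "xmon \<mu> \<in> idl.span (xi ` {k<..})" if mu: "\<mu> \<in> Poly_Mapping.keys f" for \<mu>
  proof -
    obtain i where i: "i \<in> Poly_Mapping.keys \<mu>" "i \<ge> k"
      using * mu by (auto simp: restr_eq_0_iff subset_eq not_less)
    \<comment> \<open>The exponent at i is positive, so the truncated subtraction really removes one
      factor.\<close>
    have "\<mu> = (\<mu> - Poly_Mapping.single i 1) + Poly_Mapping.single i 1"
      using i by (intro poly_mapping_eqI) (auto simp: lookup_add lookup_minus lookup_single when_def in_keys_iff)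
    then have "xmon \<mu> = xmon (\<mu> - Poly_Mapping.single i 1) * xi (Suc i)"
      by (simp add: xmon_mult)
    moreover have "xi (Suc i) \<in> idl.span (xi ` {k<..})"
      using i by (intro idl.span_base imageI) auto
    ultimately show ?thesis
      by (metis idl_mult_left)
  qed
  then show "f \<in> idl.span (xi ` {k<..})"
    by (subst steenrod_sum_xmon) (intro idl.span_sum)
qed

section \<open>Regular sequences\<close>

declare xi.simps(2) [simp del] zeta.simps(2) [simp del]

lemma xi_nonzero: "xi i \<noteq> 0"
proof
  assume "xi i = 0"
  then have "Poly_Mapping.keys (xi i) = {}" by simp
  then show False by (cases i) (simp_all add: xi.simps(2) del: keys_eq_empty)
qed

text \<open>Regularity is stated on representatives, so that the inductions never have to pass to a
  quotient ring.\<close>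

definition nonzerodiv_mod :: "'a::comm_ring_1 set \<Rightarrow> 'a \<Rightarrow> bool" where
  "nonzerodiv_mod G x \<longleftrightarrow> (\<forall>f. x * f \<in> idl.span G \<longrightarrow> f \<in> idl.span G)"

text \<open>Entries already passed are collected in G. Properness of the final ideal is kept
  separate and comes from \<open>one_notin_span\<close>.\<close>

primrec reg :: "'a::comm_ring_1 set \<Rightarrow> 'a list \<Rightarrow> bool" where
  "reg G [] \<longleftrightarrow> True"
| "reg G (x # xs) \<longleftrightarrow> nonzerodiv_mod G x \<and> reg (insert x G) xs"

lemma reg_append: "reg G (xs @ ys) \<longleftrightarrow> reg G xs \<and> reg (set xs \<union> G) ys"
  by (induction xs arbitrary: G) auto

lemma nonzerodiv_modD: "nonzerodiv_mod G x \<Longrightarrow> x * f \<in> idl.span G \<Longrightarrow> f \<in> idl.span G"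
  by (simp add: nonzerodiv_mod_def)

lemma nonzerodiv_mod_mult: "nonzerodiv_mod G x \<Longrightarrow> nonzerodiv_mod G y \<Longrightarrow> nonzerodiv_mod G (x * y)"
  unfolding nonzerodiv_mod_def mult.assoc by blast

lemma nonzerodiv_mod_power: "nonzerodiv_mod G x \<Longrightarrow> nonzerodiv_mod G (x ^ n)"
  by (induction n) (simp add: nonzerodiv_mod_def, simp add: nonzerodiv_mod_mult)

lemma nonzerodiv_mod_cong:
  assumes "nonzerodiv_mod G x" "y - x \<in> idl.span G"
  shows "nonzerodiv_mod G y"
  unfolding nonzerodiv_mod_def
proof (intro allI impI)
  fix f assume "y * f \<in> idl.span G"
  from idl.span_diff[OF this idl_mult_right[OF assms(2), of f]]
  have "y * f - (y - x) * f \<in> idl.span G" .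
  then have "x * f \<in> idl.span G" by (simp add: algebra_simps)
  then show "f \<in> idl.span G" by (rule nonzerodiv_modD[OF assms(1)])
qed

lemma span_insertE:
  assumes "x \<in> idl.span (insert a S)"
  obtains c where "x - c * a \<in> idl.span S"
  using assms by (auto simp: idl.span_insert)

lemma span_insertI: "x - c * a \<in> idl.span S \<Longrightarrow> x \<in> idl.span (insert a S)"
  by (auto simp: idl.span_insert)

lemma span_insert_mono: "x \<in> idl.span S \<Longrightarrow> x \<in> idl.span (insert a S)"
  using idl.span_mono[of S "insert a S"] by auto

lemma span_insert_eq_iff: "x - y \<in> idl.span S \<Longrightarrow> idl.span (insert x S) = idl.span (insert y S)"
proof -
  have "f \<in> idl.span (insert y S)" if xy: "x - y \<in> idl.span S" and f: "f \<in> idl.span (insert x S)" for x y f :: 'a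
  proof -
    obtain c where c: "f - c * x \<in> idl.span S"
      using f by (rule span_insertE)
    have "f - c * y = (f - c * x) + c * (x - y)"
      by (simp add: algebra_simps)
    also have "\<dots> \<in> idl.span S"
      using c xy by (intro idl.span_add idl_mult_left)
    finally show ?thesis by (rule span_insertI)
  qed
  note * = this
  assume xy: "x - y \<in> idl.span S"
  from idl.span_neg[OF xy] have yx: "y - x \<in> idl.span S" by simp
  show ?thesis
    using *[OF xy] *[OF yx] by (intro subset_antisym subsetI)
qed

text \<open>If \<open>b f\<close> lies in the ideal, then dividing repeatedly by \<open>a\<close> shows that \<open>f\<close> lies in the ideal
  plus \<open>(a^n)\<close> for every \<open>n\<close>, and \<open>a^n\<close> does not contribute in low degrees.\<close>

lemma nonzerodiv_mod_swap:
  fixes a b :: steenrod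
  assumes G: "homogeneous G" and s: "a \<in> steenrod_grading s" "s > 0"
    and a: "nonzerodiv_mod G a" and b: "nonzerodiv_mod (insert a G) b"
  shows "nonzerodiv_mod G b" "nonzerodiv_mod (insert b G) a"
proof -
  show "nonzerodiv_mod G b"
    unfolding nonzerodiv_mod_def
  proof (intro allI impI)
    fix f assume f: "b * f \<in> idl.span G"
    \<comment> \<open>The quotient g is again killed by b modulo G; this invariant lets the division
      by a continue.\<close>
    have *: "\<exists>g. f - a ^ n * g \<in> idl.span G \<and> b * g \<in> idl.span G" for n
    proof (induction n)
      case 0
      then show ?case using f by (intro exI[of _ f]) (simp add: idl.span_zero)
    next
      case (Suc n)
      then obtain g where g: "f - a ^ n * g \<in> idl.span G" "b * g \<in> idl.span G" by blast
      have "g \<in> idl.span (insert a G)"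
        by (rule nonzerodiv_modD[OF b span_insert_mono[OF g(2)]])
      then obtain c where c: "g - c * a \<in> idl.span G" by (rule span_insertE)
      have "b * g - b * (g - c * a) \<in> idl.span G"
        by (rule idl.span_diff[OF g(2) idl_mult_left[OF c]])
      then have "a * (b * c) \<in> idl.span G" by (simp add: algebra_simps)
      then have "b * c \<in> idl.span G" by (rule nonzerodiv_modD[OF a])
      moreover have "f - a ^ Suc n * c = (f - a ^ n * g) + a ^ n * (g - c * a)"
        by (simp add: algebra_simps)
      then have "f - a ^ Suc n * c \<in> idl.span G"
        by (simp only: idl.span_add[OF g(1) idl_mult_left[OF c]])
      ultimately show ?case by blast
    qed
    show "f \<in> idl.span G"
    proof (rule span_homogeneousI)
      fix t
      \<comment> \<open>As s is at least 1, the degree of a^n exceeds t. For negative t this reads n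
        = 0, and t itself lies below every degree.\<close>
      define n where "n = nat (t + 1)"
      obtain g where "f - a ^ n * g \<in> idl.span G" using * by blast
      then have "hcomp t (f - a ^ n * g) \<in> idl.span G"
        by (rule hcomp_in_span[OF G])
      moreover have "hcomp t (a ^ n * g) = a ^ n * hcomp (t - int n * s) g"
        using s by (intro hcomp_mult grading_power)
      moreover have "t - int n * s < 0"
      proof -
        have "t < int n" by (simp add: n_def)
        also have "int n * 1 \<le> int n * s" using s by (intro mult_left_mono) auto
        finally show ?thesis by simp
      qed
      then have "hcomp (t - int n * s) g = 0" by (auto simp: restr_eq_0_iff)
      ultimately show "hcomp t f \<in> idl.span G"
        by (simp add: restr_diff)
    qed
  qed
  \<comment> \<open>No grading enters here: from af = gb modulo G, regularity of b modulo a gives g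
    = ha, and cancelling a gives f = hb.\<close>
  show "nonzerodiv_mod (insert b G) a"
    unfolding nonzerodiv_mod_def
  proof (intro allI impI)
    fix f assume "a * f \<in> idl.span (insert b G)"
    then obtain g where g: "a * f - g * b \<in> idl.span G" by (rule span_insertE)
    have "b * g - f * a = - (a * f - g * b)"
      by (simp add: algebra_simps)
    then have "b * g - f * a \<in> idl.span G"
      using g by (simp only: idl.span_neg)
    then have "b * g \<in> idl.span (insert a G)" by (rule span_insertI)
    then have "g \<in> idl.span (insert a G)" by (rule nonzerodiv_modD[OF b])
    then obtain h where h: "g - h * a \<in> idl.span G" by (rule span_insertE)
    have "a * (f - h * b) = (a * f - g * b) + b * (g - h * a)"
      by (simp add: algebra_simps)
    also have "\<dots> \<in> idl.span G" using g h by (intro idl.span_add idl_mult_left)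
    finally have "f - h * b \<in> idl.span G" by (rule nonzerodiv_modD[OF a])
    then show "f \<in> idl.span (insert b G)" by (rule span_insertI)
  qed
qed

text \<open>The entry x moves past one neighbour y at a time by \<open>nonzerodiv_mod_swap\<close>;
  y then joins G and the rest of the list is treated in the same way.\<close>

lemma reg_rotate:
  assumes "homogeneous G" "homogeneous (set (x # xs))" "reg G (x # xs)"
  shows "reg G (xs @ [x])"
  using assms
proof (induction xs arbitrary: G)
  case (Cons y ys)
  obtain s where s: "x \<in> steenrod_grading s" "s > 0"
    using Cons.prems(2) by (auto simp: homogeneous_def)
  have "nonzerodiv_mod G y" "nonzerodiv_mod (insert y G) x"
    using nonzerodiv_mod_swap[OF Cons.prems(1) s] Cons.prems(3) by auto
  moreover have "reg (insert y G) (ys @ [x])"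
    using Cons.prems calculation
    by (intro Cons.IH) (auto simp: homogeneous_def insert_commute)
  ultimately show ?case by simp
qed simp

section \<open>Milnor's recursion modulo an ideal\<close>

lemma zeta_Suc: "zeta (Suc n) = (\<Sum>j\<le>n. xi (Suc n - j) ^ 2 ^ j * zeta j)"
  by (simp add: zeta.simps(2) steenrod_uminus)

text \<open>In Milnor's sum for zeta_{m+k+1} the terms with j < m contain some xi_i with i > k + 1,
  and those with j > m contain a zeta_j from the ideal. Only j = m survives.\<close>

lemma zeta_leading:
  assumes xi: "\<And>i. i > Suc k \<Longrightarrow> xi i \<in> idl.span G"
    and zeta: "\<And>i. m < i \<Longrightarrow> i \<le> m + k \<Longrightarrow> zeta i \<in> idl.span G"
  shows "zeta (Suc (m + k)) - xi (Suc k) ^ 2 ^ m * zeta m \<in> idl.span G"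
proof -
  have "zeta (Suc (m + k)) - xi (Suc k) ^ 2 ^ m * zeta m
      = (\<Sum>j\<in>{..m + k} - {m}. xi (Suc (m + k) - j) ^ 2 ^ j * zeta j)"
    unfolding zeta_Suc by (subst sum.remove[of _ m]) (auto simp: Suc_diff_le)
  also have "\<dots> \<in> idl.span G"
  proof (rule idl.span_sum)
    fix j assume j: "j \<in> {..m + k} - {m}"
    show "xi (Suc (m + k) - j) ^ 2 ^ j * zeta j \<in> idl.span G"
    proof (cases "j < m")
      case True
      then have "xi (Suc (m + k) - j) \<in> idl.span G" using j by (intro xi) auto
      \<comment> \<open>The exponent is positive, so the power still contains a factor xi.\<close>
      moreover have "(2::nat) ^ j = Suc (2 ^ j - 1)" by simp
      ultimately show ?thesis by (metis idl_mult_right power_Suc)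
    next
      case False
      then show ?thesis using j by (intro idl_mult_left zeta) auto
    qed
  qed
  finally show ?thesis .
qed

text \<open>For i > m + k each term of Milnor's sum lies in the ideal: if j > m because of zeta_j,
  by induction, and otherwise because i - j > k puts xi_{i-j} there.\<close>

lemma higher_zeta_in_span:
  assumes xi: "\<And>i. i > k \<Longrightarrow> xi i \<in> idl.span G"
    and zeta: "\<And>i. m < i \<Longrightarrow> i \<le> m + k \<Longrightarrow> zeta i \<in> idl.span G"
  shows "i > m \<Longrightarrow> zeta i \<in> idl.span G"
proof (induction i rule: less_induct)
  case (less i)
  show ?case
  proof (cases "i \<le> m + k")
    case True
    then show ?thesis using zeta less by auto
  next
    case False
    then obtain n where n: "i = Suc n" by (cases i) auto
    have "xi (Suc n - j) ^ 2 ^ j * zeta j \<in> idl.span G" if "j \<le> n" for j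
    proof (cases "j > m")
      case True
      then show ?thesis using that n by (intro idl_mult_left less.IH) auto
    next
      case False
      then have "xi (Suc n - j) \<in> idl.span G" using \<open>\<not> i \<le> m + k\<close> n by (intro xi) auto
      moreover have "(2::nat) ^ j = Suc (2 ^ j - 1)" by simp
      ultimately show ?thesis by (metis idl_mult_right power_Suc)
    qed
    then show ?thesis
      unfolding n zeta_Suc by (intro idl.span_sum) auto
  qed
qed

section \<open>The sequences zeta_{m+1}, ..., zeta_{m+k} and their regularity\<close>

definition zs :: "nat \<Rightarrow> nat \<Rightarrow> steenrod list" where
  "zs k m = map zeta [m + 1..<m + k + 1]"

lemma zs_0 [simp]: "zs 0 m = []"
  by (simp add: zs_def)

lemma zs_Suc: "zs (Suc k) m = zs k m @ [zeta (Suc (m + k))]"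
  by (simp add: zs_def)

lemma zs_Cons: "zs (Suc k) m = zeta (Suc m) # zs k (Suc m)"
  by (simp add: zs_def upt_conv_Cons del: upt_Suc)

lemma set_zs: "set (zs k m) = zeta ` {m<..m + k}"
  by (auto simp: zs_def)

text \<open>These polynomials generate the kernel of the composite projection from A_* to the final
  quotient, so that two successive quotients become one.\<close>

abbreviation gens :: "nat \<Rightarrow> nat \<Rightarrow> steenrod set" where
  "gens k m \<equiv> set (zs k m) \<union> xi ` {k<..}"

text \<open>The parameters j and k are independent because the inductions also use the intermediate
  ideals with k sequence entries and xi_i for i > k + 1.\<close>

lemma homogeneous_gens: "homogeneous (set (zs j m) \<union> xi ` {k<..})"
proof -
  have "\<exists>t>0. xi i \<in> steenrod_grading t" if "i > k" for i
    using that by (intro exI[of _ "2 ^ i - 1"] conjI grading_xi) (auto simp: one_less_power)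
  moreover have "\<exists>t>0. zeta i \<in> steenrod_grading t" if "i > m" for i
    using that by (intro exI[of _ "2 ^ i - 1"] conjI grading_zeta) (auto simp: one_less_power)
  ultimately show ?thesis
    by (auto simp: homogeneous_def set_zs)
qed

lemma homogeneous_mono: "homogeneous G \<Longrightarrow> F \<subseteq> G \<Longrightarrow> homogeneous F"
  by (auto simp: homogeneous_def)

lemma xi_greater_Suc: "insert (xi (Suc k)) (xi ` {Suc k<..}) = xi ` {k<..}"
proof -
  have "insert (Suc k) {Suc k<..} = {k<..}" by auto
  then show ?thesis by (metis image_insert)
qed

text \<open>Multiplication by xi_{k+1} does not change whether a monomial involves only xi_1, ...,
  xi_{k+1}. So it acts on normal forms, where it is injective because the polynomial ring is a
  domain.\<close>

lemma xi_nonzerodiv: "nonzerodiv_mod (xi ` {Suc k<..}) (xi (Suc k))"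
  unfolding nonzerodiv_mod_def xi_ideal_span_iff
proof (intro allI impI)
  fix f
  let ?P = "\<lambda>\<mu>. Poly_Mapping.keys \<mu> \<subseteq> {..<Suc k}"
  assume "restr ?P (xi (Suc k) * f) = 0"
  also have "restr ?P (xi (Suc k) * f) = xi (Suc k) * restr ?P f"
    by (rule restr_mult) (auto simp: subset_eq in_keys_iff lookup_add lookup_single when_def xi.simps(2) split: if_splits)
  finally show "restr ?P f = 0"
    by (simp add: xi_nonzero)
qed

lemma homogeneous_xi: "homogeneous (xi ` {k<..})"
  using homogeneous_gens[of 0 0 k] by simp

text \<open>Passing from k to k + 1 variables: xi_{k+1} is regular, killing it leads back to k
  variables, and rotation moves it to the end.\<close>

lemma reg_zs_xi:
  assumes "reg (xi ` {k<..}) (zs k m)"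
  shows "reg (xi ` {Suc k<..}) (zs k m @ [xi (Suc k)])"
proof (rule reg_rotate)
  show "homogeneous (set (xi (Suc k) # zs k m))"
    by (rule homogeneous_mono[of "set (zs k m) \<union> xi ` {0<..}"]) (use homogeneous_gens in auto)
  show "reg (xi ` {Suc k<..}) (xi (Suc k) # zs k m)"
    using assms xi_nonzerodiv by (simp add: xi_greater_Suc del: xi.simps)
qed (rule homogeneous_xi)

text \<open>The sequence for (k + 1, m) is zeta_{m+1} followed by the sequence for (k, m + 1);
  rotation moves this first entry to the end.\<close>

lemma reg_zs_zeta:
  assumes "reg (xi ` {Suc k<..}) (zs (Suc k) m)"
  shows "reg (xi ` {Suc k<..}) (zs k (Suc m) @ [zeta (Suc m)])"
proof (rule reg_rotate)
  show "homogeneous (set (zeta (Suc m) # zs k (Suc m)))"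
    unfolding zs_Cons[symmetric] by (rule homogeneous_mono[OF homogeneous_gens[of "Suc k" m k]]) auto
qed (use assms in \<open>simp_all add: zs_Cons homogeneous_xi del: zeta.simps\<close>)

lemma gens_leading:
  "zeta (Suc (m + k)) - xi (Suc k) ^ 2 ^ m * zeta m \<in> idl.span (set (zs k m) \<union> xi ` {Suc k<..})"
  by (rule zeta_leading) (auto simp: set_zs intro!: idl.span_base)

theorem reg_zs: "reg (xi ` {k<..}) (zs k m)"
proof (induction k arbitrary: m)
  case (Suc k)
  note IH = Suc.IH
  show ?case
  proof (induction m)
    case 0
    have "reg (xi ` {Suc k<..}) (zs k 0 @ [xi (Suc k)])"
      by (rule reg_zs_xi[OF IH])
    \<comment> \<open>Since zeta_0 = 1, the last entry zeta_{k+1} is congruent to xi_{k+1}.\<close>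
    moreover have "zeta (Suc (0 + k)) - xi (Suc k) \<in> idl.span (set (zs k 0) \<union> xi ` {Suc k<..})"
      using gens_leading[of 0 k] by (simp only: power_0 power_one_right zeta.simps(1) mult_1_right)
    ultimately show ?case
      by (simp only: zs_Suc reg_append reg.simps) (blast intro: nonzerodiv_mod_cong)
  next
    case (Suc m)
    have "reg (xi ` {Suc k<..}) (zs k (Suc m) @ [xi (Suc k)])"
      by (rule reg_zs_xi[OF IH])
    moreover have "reg (xi ` {Suc k<..}) (zs k (Suc m) @ [zeta (Suc m)])"
      by (rule reg_zs_zeta[OF Suc.IH])
    \<comment> \<open>The last entry is congruent to xi_{k+1}^(2^(m+1)) zeta_{m+1}, a product of
      elements regular modulo the preceding entries.\<close>
    ultimately show ?case
      using gens_leading[of "Suc m" k]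
      by (simp only: zs_Suc reg_append reg.simps)
        (blast intro: nonzerodiv_mod_cong nonzerodiv_mod_mult nonzerodiv_mod_power)
  qed
qed simp

section \<open>The socle\<close>

text \<open>This is the form in which finiteness of the quotient is carried through the induction;
  products of generators respect it.\<close>

definition nilpotent_mod :: "steenrod set \<Rightarrow> bool" where
  "nilpotent_mod G \<longleftrightarrow> (\<forall>i\<ge>1. \<exists>n. xi i ^ n \<in> idl.span G)"

text \<open>Modulo G, multiply x^n = ca by x^n' = db, where x is xi_i.\<close>

lemma nilpotent_mod_mult:
  assumes "nilpotent_mod (insert a G)" "nilpotent_mod (insert b G)"
  shows "nilpotent_mod (insert (a * b) G)"
  unfolding nilpotent_mod_def
proof (intro allI impI)
  fix i :: nat assume i: "i \<ge> 1"
  obtain n where "xi i ^ n \<in> idl.span (insert a G)"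
    using assms(1) i unfolding nilpotent_mod_def by blast
  then obtain c where c: "xi i ^ n - c * a \<in> idl.span G" by (rule span_insertE)
  obtain n' where "xi i ^ n' \<in> idl.span (insert b G)"
    using assms(2) i unfolding nilpotent_mod_def by blast
  then obtain d where d: "xi i ^ n' - d * b \<in> idl.span G" by (rule span_insertE)
  have "xi i ^ (n + n') - (c * d) * (a * b) = xi i ^ n' * (xi i ^ n - c * a) + (c * a) * (xi i ^ n' - d * b)"
    by (simp add: algebra_simps power_add)
  also have "\<dots> \<in> idl.span G"
    by (rule idl.span_add[OF idl_mult_left[OF c] idl_mult_left[OF d]])
  finally show "\<exists>n. xi i ^ n \<in> idl.span (insert (a * b) G)"
    by (blast intro: span_insertI)
qed

lemma nilpotent_mod_power:
  assumes "nilpotent_mod (insert a G)"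
  shows "nilpotent_mod (insert (a ^ n) G)"
proof (induction n)
  case 0
  have "x \<in> idl.span (insert 1 G)" for x :: steenrod
    using idl_mult_left[OF idl.span_base, of 1 "insert 1 G" x] by simp
  then show ?case by (simp add: nilpotent_mod_def)
next
  case (Suc n)
  then show ?case using nilpotent_mod_mult[OF assms] by simp
qed

lemma nilpotent_mod_cong: "idl.span G = idl.span G' \<Longrightarrow> nilpotent_mod G \<longleftrightarrow> nilpotent_mod G'"
  by (simp add: nilpotent_mod_def)

lemma higher_zeta_gens: "i > m \<Longrightarrow> zeta i \<in> idl.span (gens k m)"
  by (rule higher_zeta_in_span[where k = k and m = m]) (auto simp: set_zs intro!: idl.span_base)

text \<open>For m = 0 every zeta_j with j at least 1 lies in the ideal, and Milnor's formula solved
  for xi_n then puts xi_n there too. The quotient is thus F_2, the base of the inductions on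
  m.\<close>

lemma xi_in_span_gens_0: "i \<ge> 1 \<Longrightarrow> xi i \<in> idl.span (gens k 0)"
proof (induction i rule: less_induct)
  case (less i)
  then obtain n where n: "i = Suc n" by (cases i) auto
  have "zeta (Suc n) = xi (Suc n) + (\<Sum>j\<in>{..n} - {0}. xi (Suc n - j) ^ 2 ^ j * zeta j)"
    unfolding zeta_Suc by (subst sum.remove[of _ 0]) auto
  then have "xi (Suc n) = zeta (Suc n) - (\<Sum>j\<in>{..n} - {0}. xi (Suc n - j) ^ 2 ^ j * zeta j)"
    by (simp only: add_diff_cancel_right')
  also have "\<dots> \<in> idl.span (gens k 0)"
    by (intro idl.span_diff idl.span_sum idl_mult_left higher_zeta_gens) auto
  finally show ?case using n by simp
qed

text \<open>This and the next two lemmas describe three ideals over a common one: adjoining xi_{k+1}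
  gives the pair (k, m), adjoining the preceding zeta lowers m in k + 1 variables, and adjoining a
  power of xi_{k+1} times that zeta gives the pair (k + 1, m).\<close>

lemma gens_xi: "insert (xi (Suc k)) (set (zs k m) \<union> xi ` {Suc k<..}) = gens k m"
  using xi_greater_Suc[of k] by blast

lemma gens_zeta: "insert (zeta (Suc m)) (set (zs k (Suc m)) \<union> xi ` {Suc k<..}) = gens (Suc k) m"
  by (simp add: zs_Cons)

lemma span_gens_Suc:
  "idl.span (gens (Suc k) m)
    = idl.span (insert (xi (Suc k) ^ 2 ^ m * zeta m) (set (zs k m) \<union> xi ` {Suc k<..}))"
proof -
  have "gens (Suc k) m = insert (zeta (Suc (m + k))) (set (zs k m) \<union> xi ` {Suc k<..})"
    by (simp add: zs_Suc)
  then show ?thesis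
    using span_insert_eq_iff[OF gens_leading] by simp
qed

text \<open>The double induction parallels \<open>reg_zs\<close>: the factor xi_{k+1} is handled by
  the case of k variables, the factor zeta_{m+1} by the previous m.\<close>

lemma nilpotent_mod_gens: "nilpotent_mod (gens k m)"
proof (induction k arbitrary: m)
  case 0
  have "xi i ^ 1 \<in> idl.span (gens 0 m)" if "i \<ge> 1" for i
    using that by (auto intro: idl.span_base)
  then show ?case unfolding nilpotent_mod_def by blast
next
  case (Suc k)
  note IH = this
  show ?case
  proof (induction m)
    case 0
    have "xi i ^ 1 \<in> idl.span (gens (Suc k) 0)" if "i \<ge> 1" for i
      using xi_in_span_gens_0[OF that] by simp
    then show ?case unfolding nilpotent_mod_def by blast
  next
    case (Suc m)
    have "nilpotent_mod (insert (xi (Suc k) ^ 2 ^ Suc m) (set (zs k (Suc m)) \<union> xi ` {Suc k<..}))"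
      by (rule nilpotent_mod_power) (simp only: gens_xi IH)
    moreover have "nilpotent_mod (insert (zeta (Suc m)) (set (zs k (Suc m)) \<union> xi ` {Suc k<..}))"
      using Suc by (simp only: gens_zeta)
    ultimately show ?case
      by (subst nilpotent_mod_cong[OF span_gens_Suc]) (rule nilpotent_mod_mult)
  qed
qed

section \<open>Socle elements and how they change with the ideal\<close>

definition annihilated :: "steenrod set \<Rightarrow> steenrod \<Rightarrow> bool" where
  "annihilated G f \<longleftrightarrow> (\<forall>i\<ge>1. xi i * f \<in> idl.span G)"

lemma annihilated_xmon:
  assumes "annihilated G f" "\<mu> \<noteq> 0"
  shows "xmon \<mu> * f \<in> idl.span G"
proof -
  obtain i where i: "i \<in> Poly_Mapping.keys \<mu>"
    using assms(2) by (metis keys_eq_empty all_not_in_conv)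
  have "\<mu> = (\<mu> - Poly_Mapping.single i 1) + Poly_Mapping.single i 1"
    using i by (intro poly_mapping_eqI) (auto simp: lookup_add lookup_minus lookup_single when_def in_keys_iff)
  then have "xmon \<mu> * f = xmon (\<mu> - Poly_Mapping.single i 1) * (xi (Suc i) * f)"
    by (simp add: xmon_mult xi.simps(2) flip: mult.assoc)
  then show ?thesis
    using assms(1) unfolding annihilated_def by (metis idl_mult_left le_add1 plus_1_eq_Suc)
qed

text \<open>A homogeneous element of positive degree has no constant term, so each of its monomials
  contains some xi_i.\<close>

lemma annihilated_grading:
  assumes "annihilated G f" "a \<in> steenrod_grading s" "s > 0"
  shows "a * f \<in> idl.span G"
proof -
  have "a * f = (\<Sum>\<mu>\<in>Poly_Mapping.keys a. xmon \<mu> * f)"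
    by (subst steenrod_sum_xmon) (simp add: sum_distrib_right)
  also have "\<dots> \<in> idl.span G"
  proof (intro idl.span_sum annihilated_xmon[OF assms(1)] notI)
    fix \<mu> assume "\<mu> \<in> Poly_Mapping.keys a" "\<mu> = 0"
    with assms(2,3) show False by (auto simp: steenrod_grading_def)
  qed
  finally show ?thesis .
qed

text \<open>A one-dimensional space over F_2 has a single nonzero element. One-dimensionality of the
  socle is therefore expressed by saying that all its nonzero elements are congruent to w.\<close>

definition socle_generator :: "steenrod set \<Rightarrow> int \<Rightarrow> steenrod \<Rightarrow> bool" where
  "socle_generator G d w \<longleftrightarrow> w \<in> steenrod_grading d \<and> w \<notin> idl.span G \<and> annihilated G w \<and>
     (\<forall>f. annihilated G f \<longrightarrow> f \<notin> idl.span G \<longrightarrow> f - w \<in> idl.span G)"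

lemma socle_generator_cong:
  "idl.span G = idl.span G' \<Longrightarrow> socle_generator G d w \<longleftrightarrow> socle_generator G' d w"
  by (simp add: socle_generator_def annihilated_def)

text \<open>As b is regular, bf lies in (ab) exactly when f lies in (a), so b embeds the quotient by
  (a) into that by (ab). A socle element f modulo (ab) is killed by a, which has positive degree;
  from af = cab and regularity of a follows f = bc, and c is a socle element modulo (a).\<close>

lemma socle_generator_mult:
  assumes a: "nonzerodiv_mod G a" "a \<in> steenrod_grading s" "s > 0"
    and b: "nonzerodiv_mod G b" "b \<in> steenrod_grading e"
    and w: "socle_generator (insert a G) d w"
  shows "socle_generator (insert (a * b) G) (e + d) (b * w)"
proof -
  have up: "b * f \<in> idl.span (insert (a * b) G)" if f: "f \<in> idl.span (insert a G)" for f
  proof -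
    obtain c where c: "f - c * a \<in> idl.span G" using f by (rule span_insertE)
    from idl_mult_left[OF c, of b] show ?thesis
      by (intro span_insertI[of _ c]) (simp add: algebra_simps)
  qed
  have down: "f \<in> idl.span (insert a G)" if f: "b * f \<in> idl.span (insert (a * b) G)" for f
  proof -
    obtain c where "b * f - c * (a * b) \<in> idl.span G" using f by (rule span_insertE)
    then have "b * (f - c * a) \<in> idl.span G" by (simp add: algebra_simps)
    then have "f - c * a \<in> idl.span G" by (rule nonzerodiv_modD[OF b(1)])
    then show ?thesis by (rule span_insertI)
  qed
  have "f - b * w \<in> idl.span (insert (a * b) G)"
    if f: "annihilated (insert (a * b) G) f" "f \<notin> idl.span (insert (a * b) G)" for f
  proof -
    obtain c where "a * f - c * (a * b) \<in> idl.span G"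
      using annihilated_grading[OF f(1) a(2,3)] by (rule span_insertE)
    then have "a * (f - b * c) \<in> idl.span G" by (simp add: algebra_simps)
    then have c: "f - b * c \<in> idl.span (insert (a * b) G)"
      by (rule span_insert_mono[OF nonzerodiv_modD[OF a(1)]])
    have "xi i * c \<in> idl.span (insert a G)" if i: "i \<ge> 1" for i
    proof (rule down)
      have "xi i * f \<in> idl.span (insert (a * b) G)" using f(1) i by (simp add: annihilated_def)
      from idl.span_diff[OF this idl_mult_left[OF c, of "xi i"]]
      show "b * (xi i * c) \<in> idl.span (insert (a * b) G)" by (simp add: algebra_simps)
    qed
    then have "annihilated (insert a G) c" by (simp add: annihilated_def)
    moreover have "c \<notin> idl.span (insert a G)"
    proof
      assume "c \<in> idl.span (insert a G)"
      from idl.span_add[OF c up[OF this]] f(2) show False by simp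
    qed
    ultimately have "c - w \<in> idl.span (insert a G)"
      using w by (simp add: socle_generator_def)
    from idl.span_add[OF c up[OF this]] show ?thesis by (simp add: algebra_simps)
  qed
  moreover have "annihilated (insert (a * b) G) (b * w)"
    unfolding annihilated_def
  proof (intro allI impI)
    fix i :: nat assume "i \<ge> 1"
    then have "b * (xi i * w) \<in> idl.span (insert (a * b) G)"
      using w by (intro up) (simp add: socle_generator_def annihilated_def)
    then show "xi i * (b * w) \<in> idl.span (insert (a * b) G)"
      by (simp add: mult.left_commute)
  qed
  moreover have "b * w \<notin> idl.span (insert (a * b) G)" "b * w \<in> steenrod_grading (e + d)"
    using w down grading_mult[OF b(2)] by (auto simp: socle_generator_def)
  ultimately show ?thesis unfolding socle_generator_def by blast
qed

text \<open>Here the quotient is F_2: f is congruent to its constant term, which is 1 when f lies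
  outside the ideal.\<close>

lemma socle_generator_one:
  assumes G: "homogeneous G" and xi: "\<And>i. i \<ge> 1 \<Longrightarrow> xi i \<in> idl.span G"
  shows "socle_generator G 0 1"
proof -
  have ann: "annihilated G 1" using xi by (simp add: annihilated_def)
  have "f - 1 \<in> idl.span G" if "f \<notin> idl.span G" for f
  proof -
    let ?g = "\<Sum>\<mu>\<in>Poly_Mapping.keys f - {0}. xmon \<mu>"
    have g: "?g \<in> idl.span G"
      using annihilated_xmon[OF ann] by (intro idl.span_sum) auto
    show ?thesis
    proof (cases "0 \<in> Poly_Mapping.keys f")
      case True
      then have "f = 1 + ?g"
        by (subst steenrod_sum_xmon) (simp add: sum.remove)
      then show ?thesis using g by (metis add_diff_cancel_left')
    next
      case False
      then have "f = ?g" by (subst steenrod_sum_xmon) simp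
      then show ?thesis using g that by metis
    qed
  qed
  then show ?thesis
    using ann one_notin_span[OF G] by (simp add: socle_generator_def grading_one)
qed

text \<open>Each element ends a rotated regular sequence, so it is regular modulo all other
  entries.\<close>

lemma nonzerodiv_gens:
  "nonzerodiv_mod (set (zs k m) \<union> xi ` {Suc k<..}) (xi (Suc k))"
  "nonzerodiv_mod (set (zs k (Suc m)) \<union> xi ` {Suc k<..}) (zeta (Suc m))"
  using reg_zs_xi[OF reg_zs, of k m] reg_zs_zeta[OF reg_zs, of k m] by (simp_all add: reg_append)

text \<open>This equals (2^m - 1)(2^(k+1) - 2), the sum over i = 1, ..., k of the degree of
  zeta_{m+i} minus that of xi_i. It vanishes for k = 0 and for m = 0.\<close>

definition top_degree :: "nat \<Rightarrow> nat \<Rightarrow> int" where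
  "top_degree k m = 2 ^ (m + k + 1) - 2 ^ (m + 1) - 2 ^ (k + 1) + 2"

lemma ex_socle_generator_gens: "\<exists>w. socle_generator (gens k m) (top_degree k m) w"
proof (cases k)
  case 0
  have "socle_generator (gens 0 m) 0 1"
    by (rule socle_generator_one[OF homogeneous_gens]) (auto intro: idl.span_base)
  then show ?thesis
    using 0 by (auto simp: top_degree_def)
next
  case (Suc k')
  show ?thesis
    unfolding Suc
  proof (induction m)
    case 0
    then show ?case
      using socle_generator_one[OF homogeneous_gens xi_in_span_gens_0, of "Suc k'"]
      by (auto simp: top_degree_def)
  next
    case (Suc m)
    then obtain w where w: "socle_generator (gens (Suc k') m) (top_degree (Suc k') m) w" by blast
    let ?G = "set (zs k' (Suc m)) \<union> xi ` {Suc k'<..}" and ?b = "xi (Suc k') ^ 2 ^ Suc m"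
    have "socle_generator (insert (zeta (Suc m) * ?b) ?G)
        (int (2 ^ Suc m) * (2 ^ Suc k' - 1) + top_degree (Suc k') m) (?b * w)"
    proof (rule socle_generator_mult)
      show "zeta (Suc m) \<in> steenrod_grading (2 ^ Suc m - 1)" by (rule grading_zeta)
      show "?b \<in> steenrod_grading (int (2 ^ Suc m) * (2 ^ Suc k' - 1))"
        by (intro grading_power grading_xi)
      show "socle_generator (insert (zeta (Suc m)) ?G) (top_degree (Suc k') m) w"
        using w by (simp only: gens_zeta)
      show "(0::int) < 2 ^ Suc m - 1" using one_less_power[of "2::int" "Suc m"] by simp
    qed (rule nonzerodiv_gens nonzerodiv_mod_power[OF nonzerodiv_gens(1)])+
    \<comment> \<open>The top degree grows by exactly the degree of the factor
      \<open>?b\<close>.\<close>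
    moreover have "int (2 ^ Suc m) * (2 ^ Suc k' - 1) + top_degree (Suc k') m = top_degree (Suc k') (Suc m)"
      by (simp add: top_degree_def algebra_simps power_add)
    ultimately show ?case
      by (auto simp: socle_generator_cong[OF span_gens_Suc] mult.commute[of _ "zeta (Suc m)"])
  qed
qed

section \<open>Perfect pairings over the field with two elements\<close>

declare add_bit_eq_xor [simp del] mult_bit_eq_and [simp del]
  \<comment> \<open>they would rewrite inside \<open>class_ring\<close>\<close>

text \<open>The involution s exchanges the elements satisfying h with those violating it.\<close>

lemma half_card:
  assumes "finite X" and s: "\<And>x. x \<in> X \<Longrightarrow> s x \<in> X \<and> s (s x) = x \<and> (h (s x) \<longleftrightarrow> \<not> h x)"
  shows "2 * card {x \<in> X. h x} = card X"
proof -
  have "bij_betw s {x \<in> X. h x} {x \<in> X. \<not> h x}"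
    by (rule bij_betw_byWitness[where f' = s]) (use s in auto)
  then have "card {x \<in> X. h x} = card {x \<in> X. \<not> h x}"
    by (rule bij_betw_same_card)
  moreover have "card X = card {x \<in> X. h x} + card {x \<in> X. \<not> h x}"
    using assms(1) by (subst card_Un_disjoint[symmetric]) (auto intro: arg_cong[where f = card])
  ultimately show ?thesis by simp
qed

text \<open>Double counting of the pairs \<open>(v, w)\<close> with \<open>b v w\<close>.\<close>

lemma card_eq_if_halving:
  assumes fin: "finite V" "finite W" and "v0 \<in> V" "w0 \<in> W"
    and v0: "\<And>w. w \<in> W \<Longrightarrow> \<not> b v0 w" and w0: "\<And>v. v \<in> V \<Longrightarrow> \<not> b v w0"
    and V: "\<And>v. v \<in> V \<Longrightarrow> v \<noteq> v0 \<Longrightarrow> 2 * card {w \<in> W. b v w} = card W"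
    and W: "\<And>w. w \<in> W \<Longrightarrow> w \<noteq> w0 \<Longrightarrow> 2 * card {v \<in> V. b v w} = card V"
  shows "card V = card W"
proof -
  \<comment> \<open>The element v0 occurs in no pair, and every other v occurs in half of the
    possible ones.\<close>
  have "2 * (\<Sum>v\<in>V. card {w \<in> W. b v w}) = (\<Sum>v\<in>V - {v0}. 2 * card {w \<in> W. b v w})"
    using assms by (simp add: sum.remove[of V v0] sum_distrib_left)
  also have "\<dots> = (card V - 1) * card W"
    using V fin \<open>v0 \<in> V\<close> by simp
  finally have 1: "2 * (\<Sum>v\<in>V. card {w \<in> W. b v w}) = (card V - 1) * card W" .
  have "2 * (\<Sum>w\<in>W. card {v \<in> V. b v w}) = (\<Sum>w\<in>W - {w0}. 2 * card {v \<in> V. b v w})"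
    using assms by (simp add: sum.remove[of W w0] sum_distrib_left)
  also have "\<dots> = (card W - 1) * card V"
    using W fin \<open>w0 \<in> W\<close> by simp
  finally have 2: "2 * (\<Sum>w\<in>W. card {v \<in> V. b v w}) = (card W - 1) * card V" .
  have "(\<Sum>v\<in>V. card {w \<in> W. b v w}) = (\<Sum>v\<in>V. \<Sum>w\<in>W. of_bool (b v w))"
    using fin by (simp add: Int_def)
  also have "\<dots> = (\<Sum>w\<in>W. \<Sum>v\<in>V. of_bool (b v w))"
    by (rule sum.swap)
  also have "\<dots> = (\<Sum>w\<in>W. card {v \<in> V. b v w})"
    using fin by (simp add: Int_def)
  finally have "(card V - 1) * card W = (card W - 1) * card V"
    using 1 2 by simp
  \<comment> \<open>Positivity makes the truncated differences genuine, so the equation can be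
    solved.\<close>
  moreover have "card V > 0" "card W > 0"
    using assms card_gt_0_iff by blast+
  ultimately show ?thesis
    by (cases "card V"; cases "card W") auto
qed

section \<open>Linear maps and adjoints over F_2\<close>

lemma f2_add_self:
  fixes V :: "(bit, 'v, 'm) module_scheme"
  assumes "module class_ring V" "x \<in> carrier V"
  shows "x \<oplus>\<^bsub>V\<^esub> x = \<zero>\<^bsub>V\<^esub>"
proof -
  interpret Module.module "class_ring :: bit ring" V by fact
  have "x \<oplus>\<^bsub>V\<^esub> x = (1 + 1 :: bit) \<odot>\<^bsub>V\<^esub> x"
    using smult_l_distr[of "1::bit" "1::bit" x] smult_one[of x] assms(2) by simp
  also have "\<dots> = \<zero>\<^bsub>V\<^esub>"
    using smult_l_null[of x] assms(2) by simp
  finally show ?thesis .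
qed

lemma f2_add_add_self:
  fixes V :: "(bit, 'v, 'm) module_scheme"
  assumes "module class_ring V" "x \<in> carrier V" "y \<in> carrier V"
  shows "(x \<oplus>\<^bsub>V\<^esub> y) \<oplus>\<^bsub>V\<^esub> y = x"
proof -
  interpret Module.module "class_ring :: bit ring" V by fact
  show ?thesis using assms f2_add_self[OF assms(1,3)] by (simp add: M.a_assoc)
qed

text \<open>The only scalars are 0 and 1, so additivity suffices; f 0 = 0 follows from f 0 = f 0 + f
  0 = 0.\<close>

lemma f2_module_homI:
  fixes V :: "(bit, 'v, 'm) module_scheme" and L :: "(bit, 'l, 'n) module_scheme"
  assumes V: "module class_ring V" and L: "module class_ring L"
    and closed: "\<And>x. x \<in> carrier V \<Longrightarrow> f x \<in> carrier L"
    and add: "\<And>x y. x \<in> carrier V \<Longrightarrow> y \<in> carrier V \<Longrightarrow> f (x \<oplus>\<^bsub>V\<^esub> y) = f x \<oplus>\<^bsub>L\<^esub> f y"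
  shows "f \<in> LinearCombinations.module_hom class_ring V L"
proof -
  interpret V: Module.module "class_ring :: bit ring" V by fact
  interpret L: Module.module "class_ring :: bit ring" L by fact
  have f0: "f \<zero>\<^bsub>V\<^esub> = \<zero>\<^bsub>L\<^esub>"
    using add[of "\<zero>\<^bsub>V\<^esub>" "\<zero>\<^bsub>V\<^esub>"] f2_add_self[OF L closed[of "\<zero>\<^bsub>V\<^esub>"]] by simp
  have "f (c \<odot>\<^bsub>V\<^esub> x) = c \<odot>\<^bsub>L\<^esub> f x" if "x \<in> carrier V" for c x
    using that f0 closed[OF that] V.smult_l_null[of x] L.smult_l_null[of "f x"]
      V.smult_one[of x] L.smult_one[of "f x"]
    by (cases c) simp_all
  then show ?thesis
    using closed add by (simp add: LinearCombinations.module_hom_def)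
qed

text \<open>Both \<open>V\<close> and \<open>Hom(W, L)\<close> pair nondegenerately with \<open>W\<close>, so both have the cardinality of \<open>W\<close>, and
  the injective adjoint map is bijective.\<close>

lemma f2_adjoint_bij:
  fixes V :: "(bit, 'v, 'm) module_scheme" and W :: "(bit, 'w, 'n) module_scheme"
    and L :: "(bit, 'l, 'o) module_scheme"
  assumes V: "module class_ring V" "finite (carrier V)"
    and W: "module class_ring W" "finite (carrier W)"
    and L: "module class_ring L" "carrier L = {\<zero>\<^bsub>L\<^esub>, e}" "e \<noteq> \<zero>\<^bsub>L\<^esub>"
    and closed: "\<And>v w. v \<in> carrier V \<Longrightarrow> w \<in> carrier W \<Longrightarrow> b v w \<in> carrier L"
    and add_right: "\<And>v w w'. v \<in> carrier V \<Longrightarrow> w \<in> carrier W \<Longrightarrow> w' \<in> carrier W \<Longrightarrow>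
      b v (w \<oplus>\<^bsub>W\<^esub> w') = b v w \<oplus>\<^bsub>L\<^esub> b v w'"
    and add_left: "\<And>v v' w. v \<in> carrier V \<Longrightarrow> v' \<in> carrier V \<Longrightarrow> w \<in> carrier W \<Longrightarrow>
      b (v \<oplus>\<^bsub>V\<^esub> v') w = b v w \<oplus>\<^bsub>L\<^esub> b v' w"
    and nondeg_left: "\<And>v. v \<in> carrier V \<Longrightarrow> v \<noteq> \<zero>\<^bsub>V\<^esub> \<Longrightarrow> \<exists>w\<in>carrier W. b v w \<noteq> \<zero>\<^bsub>L\<^esub>"
    and nondeg_right: "\<And>w. w \<in> carrier W \<Longrightarrow> w \<noteq> \<zero>\<^bsub>W\<^esub> \<Longrightarrow> \<exists>v\<in>carrier V. b v w \<noteq> \<zero>\<^bsub>L\<^esub>"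
  shows "bij_betw (\<lambda>v. restrict (b v) (carrier W)) (carrier V)
    (LinearCombinations.module_hom class_ring W L \<inter> extensional (carrier W))"
proof -
  interpret V: Module.module "class_ring :: bit ring" V by fact
  interpret W: Module.module "class_ring :: bit ring" W by fact
  interpret L: Module.module "class_ring :: bit ring" L by fact
  let ?H = "LinearCombinations.module_hom class_ring W L \<inter> extensional (carrier W)"
  let ?a = "\<lambda>v. restrict (b v) (carrier W)"
  have e: "e \<in> carrier L" using L by simp
  have ee: "e \<oplus>\<^bsub>L\<^esub> e = \<zero>\<^bsub>L\<^esub>" by (rule f2_add_self[OF L(1) e])
  \<comment> \<open>Since L has only the elements 0 and e, adding a nonzero y toggles between
    them.\<close>
  have flip: "x \<oplus>\<^bsub>L\<^esub> y = e \<longleftrightarrow> \<not> x = e" if "x \<in> carrier L" "y \<in> carrier L" "y \<noteq> \<zero>\<^bsub>L\<^esub>" for x y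
    using that e ee L by auto
  have b0r: "b v \<zero>\<^bsub>W\<^esub> = \<zero>\<^bsub>L\<^esub>" if "v \<in> carrier V" for v
    using add_right[OF that, of "\<zero>\<^bsub>W\<^esub>" "\<zero>\<^bsub>W\<^esub>"] f2_add_self[OF L(1) closed[OF that W.zero_closed]] by simp
  have b0l: "b \<zero>\<^bsub>V\<^esub> w = \<zero>\<^bsub>L\<^esub>" if "w \<in> carrier W" for w
    using add_left[OF _ _ that, of "\<zero>\<^bsub>V\<^esub>" "\<zero>\<^bsub>V\<^esub>"] f2_add_self[OF L(1) closed[OF V.zero_closed that]] by simp
  have homD: "h x \<in> carrier L" "h (x \<oplus>\<^bsub>W\<^esub> y) = h x \<oplus>\<^bsub>L\<^esub> h y"
    if "h \<in> ?H" "x \<in> carrier W" "y \<in> carrier W" for h x y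
    using that by (auto simp: LinearCombinations.module_hom_def)
  have homI: "restrict f (carrier W) \<in> ?H"
    if "\<And>x. x \<in> carrier W \<Longrightarrow> f x \<in> carrier L"
      "\<And>x y. x \<in> carrier W \<Longrightarrow> y \<in> carrier W \<Longrightarrow> f (x \<oplus>\<^bsub>W\<^esub> y) = f x \<oplus>\<^bsub>L\<^esub> f y" for f
    using that by (auto intro!: f2_module_homI W(1) L(1))
  have hom0: "h \<zero>\<^bsub>W\<^esub> = \<zero>\<^bsub>L\<^esub>" if "h \<in> ?H" for h
    using homD(2)[OF that, of "\<zero>\<^bsub>W\<^esub>" "\<zero>\<^bsub>W\<^esub>"] f2_add_self[OF L(1) homD(1)[OF that, of "\<zero>\<^bsub>W\<^esub>" "\<zero>\<^bsub>W\<^esub>"]] by simp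
  have aH: "?a v \<in> ?H" if "v \<in> carrier V" for v
    using that closed add_right by (intro homI) auto
  have "finite (carrier W \<rightarrow>\<^sub>E carrier L)"
    using W(2) L(2) by (intro finite_PiE) auto
  moreover have "?H \<subseteq> carrier W \<rightarrow>\<^sub>E carrier L"
    using homD(1) by (auto simp: PiE_def)
  ultimately have finH: "finite ?H" by (rule finite_subset[rotated])
  \<comment> \<open>Translation by a vector x with h x = e is an involution that toggles the value
    of h.\<close>
  have halfW: "2 * card {w \<in> carrier W. h w = e} = card (carrier W)"
    if h: "h \<in> ?H" and x: "x \<in> carrier W" "h x \<noteq> \<zero>\<^bsub>L\<^esub>" for h x
    by (rule half_card[where s = "\<lambda>y. y \<oplus>\<^bsub>W\<^esub> x"])
      (use W h x in \<open>auto simp: f2_add_add_self homD flip\<close>)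
  have nz: "y = e" if "y \<in> carrier L" "y \<noteq> \<zero>\<^bsub>L\<^esub>" for y
    using that L by auto
  have "card (carrier V) = card (carrier W)"
  proof (rule card_eq_if_halving[where b = "\<lambda>v w. b v w = e" and ?v0.0 = "\<zero>\<^bsub>V\<^esub>" and ?w0.0 = "\<zero>\<^bsub>W\<^esub>"])
    fix v assume v: "v \<in> carrier V" "v \<noteq> \<zero>\<^bsub>V\<^esub>"
    then obtain x where "x \<in> carrier W" "b v x \<noteq> \<zero>\<^bsub>L\<^esub>" using nondeg_left by blast
    moreover have "{w \<in> carrier W. ?a v w = e} = {w \<in> carrier W. b v w = e}" by auto
    ultimately show "2 * card {w \<in> carrier W. b v w = e} = card (carrier W)"
      using halfW[OF aH[OF v(1)], of x] by simp
  next
    fix w assume w: "w \<in> carrier W" "w \<noteq> \<zero>\<^bsub>W\<^esub>"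
    then obtain x where x: "x \<in> carrier V" "b x w \<noteq> \<zero>\<^bsub>L\<^esub>" using nondeg_right by blast
    show "2 * card {v \<in> carrier V. b v w = e} = card (carrier V)"
      by (rule half_card[where s = "\<lambda>y. y \<oplus>\<^bsub>V\<^esub> x"])
        (use V w x closed in \<open>auto simp: f2_add_add_self add_left flip\<close>)
  qed (use V W b0l b0r L(3) in auto)
  moreover have "card ?H = card (carrier W)"
  proof (rule card_eq_if_halving[where b = "\<lambda>h w. h w = e" and ?w0.0 = "\<zero>\<^bsub>W\<^esub>"
      and ?v0.0 = "restrict (\<lambda>_. \<zero>\<^bsub>L\<^esub>) (carrier W)"])
    show "restrict (\<lambda>_. \<zero>\<^bsub>L\<^esub>) (carrier W) \<in> ?H" by (rule homI) auto
  next
    fix h assume h: "h \<in> ?H" "h \<noteq> restrict (\<lambda>_. \<zero>\<^bsub>L\<^esub>) (carrier W)"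
    have "\<exists>x\<in>carrier W. h x \<noteq> \<zero>\<^bsub>L\<^esub>"
    proof (rule ccontr)
      assume "\<not> ?thesis"
      then have "h = restrict (\<lambda>_. \<zero>\<^bsub>L\<^esub>) (carrier W)"
        using h(1) by (intro extensionalityI[of _ "carrier W"]) auto
      with h(2) show False by simp
    qed
    then show "2 * card {w \<in> carrier W. h w = e} = card (carrier W)"
      using halfW[OF h(1)] by blast
  next
    fix w assume w: "w \<in> carrier W" "w \<noteq> \<zero>\<^bsub>W\<^esub>"
    then obtain v where v: "v \<in> carrier V" "b v w \<noteq> \<zero>\<^bsub>L\<^esub>" using nondeg_right by blast
    \<comment> \<open>Translation by the functional of v toggles the value at w, because b v w =
      e.\<close>
    let ?s = "\<lambda>h. restrict (\<lambda>y. h y \<oplus>\<^bsub>L\<^esub> b v y) (carrier W)"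
    show "2 * card {h \<in> ?H. h w = e} = card ?H"
    proof (rule half_card[where s = ?s, OF finH], intro conjI)
      fix h assume h: "h \<in> ?H"
      show "?s h \<in> ?H"
        using h v(1) closed by (intro homI) (auto simp: homD add_right L.M.add.m_ac)
      show "?s (?s h) = h"
        using h v(1) closed
        by (intro extensionalityI[of _ "carrier W"]) (auto simp: f2_add_add_self[OF L(1)] homD)
      show "(?s h w = e) = (h w \<noteq> e)"
        using h v w(1) closed by (simp add: flip homD)
    qed
  qed (use W finH hom0 L(3) in auto)
  ultimately have card: "card (carrier V) = card ?H" by simp
  have inj: "inj_on ?a (carrier V)"
  proof (rule inj_onI)
    fix v v' assume v: "v \<in> carrier V" "v' \<in> carrier V" and eq: "?a v = ?a v'"
    \<comment> \<open>Equality of the adjoints means that v + v' pairs to zero with everything; in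
      characteristic 2 its vanishing is the equality v = v'.\<close>
    have "b (v \<oplus>\<^bsub>V\<^esub> v') w = \<zero>\<^bsub>L\<^esub>" if "w \<in> carrier W" for w
      using fun_cong[OF eq, of w] that v closed by (simp add: add_left f2_add_self[OF L(1)])
    then have "v \<oplus>\<^bsub>V\<^esub> v' = \<zero>\<^bsub>V\<^esub>"
      using nondeg_left[of "v \<oplus>\<^bsub>V\<^esub> v'"] v by auto
    then have "(v \<oplus>\<^bsub>V\<^esub> v') \<oplus>\<^bsub>V\<^esub> v' = v'"
      using v by simp
    then show "v = v'"
      using v by (simp add: f2_add_add_self[OF V(1)])
  qed
  moreover have "?a ` carrier V = ?H"
    using aH by (intro card_subset_eq[OF finH]) (auto simp: card_image[OF inj] card)
  ultimately show ?thesis by (simp add: bij_betw_def)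
qed

lemma f2_perfect_pairingI:
  fixes V :: "(bit, 'v) module" and W :: "(bit, 'w) module" and L :: "(bit, 'l) module"
  assumes V: "module class_ring V" "finite (carrier V)"
    and W: "module class_ring W" "finite (carrier W)"
    and L: "module class_ring L" "carrier L = {\<zero>\<^bsub>L\<^esub>, e}" "e \<noteq> \<zero>\<^bsub>L\<^esub>"
    and closed: "\<And>v w. v \<in> carrier V \<Longrightarrow> w \<in> carrier W \<Longrightarrow> b v w \<in> carrier L"
    and add_right: "\<And>v w w'. v \<in> carrier V \<Longrightarrow> w \<in> carrier W \<Longrightarrow> w' \<in> carrier W \<Longrightarrow>
      b v (w \<oplus>\<^bsub>W\<^esub> w') = b v w \<oplus>\<^bsub>L\<^esub> b v w'"
    and add_left: "\<And>v v' w. v \<in> carrier V \<Longrightarrow> v' \<in> carrier V \<Longrightarrow> w \<in> carrier W \<Longrightarrow>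
      b (v \<oplus>\<^bsub>V\<^esub> v') w = b v w \<oplus>\<^bsub>L\<^esub> b v' w"
    and nondeg_left: "\<And>v. v \<in> carrier V \<Longrightarrow> v \<noteq> \<zero>\<^bsub>V\<^esub> \<Longrightarrow> \<exists>w\<in>carrier W. b v w \<noteq> \<zero>\<^bsub>L\<^esub>"
    and nondeg_right: "\<And>w. w \<in> carrier W \<Longrightarrow> w \<noteq> \<zero>\<^bsub>W\<^esub> \<Longrightarrow> \<exists>v\<in>carrier V. b v w \<noteq> \<zero>\<^bsub>L\<^esub>"
  shows "perfect_pairing class_ring V W L b"
  unfolding perfect_pairing_def
proof (intro conjI ballI)
  show "bij_betw (\<lambda>v. restrict (b v) (carrier W)) (carrier V)
      (LinearCombinations.module_hom class_ring W L \<inter> extensional (carrier W))"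
    by (rule f2_adjoint_bij[OF V W L closed add_right add_left nondeg_left nondeg_right])
  show "bij_betw (\<lambda>w. restrict (\<lambda>v. b v w) (carrier V)) (carrier W)
      (LinearCombinations.module_hom class_ring V L \<inter> extensional (carrier V))"
    by (rule f2_adjoint_bij[OF W V L, where b = "\<lambda>w v. b v w"])
      (use closed add_right add_left nondeg_left nondeg_right in auto)
next
  fix v assume "v \<in> carrier V"
  then show "b v \<in> LinearCombinations.module_hom class_ring W L"
    using closed add_right by (intro f2_module_homI W(1) L(1)) auto
next
  fix w assume "w \<in> carrier W"
  then show "(\<lambda>v. b v w) \<in> LinearCombinations.module_hom class_ring V L"
    using closed add_left by (intro f2_module_homI V(1) L(1)) auto
qed

section \<open>Quotient algebras\<close>

text \<open>This exhibits A as F_2[xi_1, xi_2, ...]/(G) through p, so that coset computations become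
  ideal membership of polynomials. Scalars are 0 or 1, hence the case distinction.\<close>

definition presentation :: "(bit, 'a) module \<Rightarrow> (steenrod \<Rightarrow> 'a) \<Rightarrow> steenrod set \<Rightarrow> bool" where
  "presentation A p G \<longleftrightarrow> carrier A = range p \<and> (\<forall>f g. p f = p g \<longleftrightarrow> f - g \<in> idl.span G) \<and>
     (\<forall>f g. p f \<otimes>\<^bsub>A\<^esub> p g = p (f * g)) \<and> (\<forall>f g. p f \<oplus>\<^bsub>A\<^esub> p g = p (f + g)) \<and>
     \<one>\<^bsub>A\<^esub> = p 1 \<and> \<zero>\<^bsub>A\<^esub> = p 0 \<and> (\<forall>c f. c \<odot>\<^bsub>A\<^esub> p f = (if c = 0 then p 0 else p f))"

lemma presentationD:
  assumes "presentation A p G"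
  shows "carrier A = range p" "p f = p g \<longleftrightarrow> f - g \<in> idl.span G"
    "p f \<otimes>\<^bsub>A\<^esub> p g = p (f * g)" "p f \<oplus>\<^bsub>A\<^esub> p g = p (f + g)" "\<one>\<^bsub>A\<^esub> = p 1" "\<zero>\<^bsub>A\<^esub> = p 0"
    "c \<odot>\<^bsub>A\<^esub> p f = (if c = 0 then p 0 else p f)"
  using assms unfolding presentation_def by blast+

lemma presentation_eq_0:
  assumes "presentation A p G"
  shows "p f = p 0 \<longleftrightarrow> f \<in> idl.span G"
  by (simp add: presentationD(2)[OF assms])

lemma presentation_cring:
  assumes "presentation A p G"
  shows "cring A"
proof (rule cringI)
  note P = presentationD[OF assms]
  show "abelian_group A"
  proof (rule abelian_groupI)
    fix x assume "x \<in> carrier A"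
    then obtain f where f: "x = p f" by (auto simp: P(1))
    then show "\<exists>y\<in>carrier A. y \<oplus>\<^bsub>A\<^esub> x = \<zero>\<^bsub>A\<^esub>"
      by (intro bexI[of _ "p (- f)"]) (auto simp: P)
  qed (auto simp: P(1,3-7) ac_simps)
  show "comm_monoid A"
    by (rule comm_monoidI) (auto simp: P(1,3-7) ac_simps)
qed (use presentationD[OF assms] in \<open>auto simp: distrib_right\<close>)

lemma presentation_a_inv:
  assumes "presentation A p G"
  shows "\<ominus>\<^bsub>A\<^esub> p f = p (- f)"
proof -
  note P = presentationD[OF assms]
  interpret cring A by (rule presentation_cring[OF assms])
  show ?thesis
    by (rule minus_equality) (auto simp: P)
qed

lemma presentation_algebra:
  assumes "presentation A p G"
  shows "algebra class_ring A"
proof (rule algebraI)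
  note P = presentationD[OF assms]
  show "cring (class_ring :: bit ring)" by (rule class_cring.is_cring)
  show "cring A" by (rule presentation_cring[OF assms])
  fix a b :: bit and x y
  assume "x \<in> carrier A" "y \<in> carrier A"
  show "(a \<oplus>\<^bsub>class_ring\<^esub> b) \<odot>\<^bsub>A\<^esub> x = a \<odot>\<^bsub>A\<^esub> x \<oplus>\<^bsub>A\<^esub> b \<odot>\<^bsub>A\<^esub> x"
    using \<open>x \<in> carrier A\<close> by (cases a; cases b) (auto simp: P(1,3-7) steenrod_add_self)
qed (auto simp: presentationD(1,3-7)[OF assms])

text \<open>Since p is onto, the image of an ideal is an ideal, which gives one inclusion. For the
  other, elements of G are sent to zero and those of S to generators.\<close>

lemma presentation_genideal:
  assumes "presentation A p G"
  shows "Idl\<^bsub>A\<^esub> (p ` S) = p ` idl.span (S \<union> G)"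
proof -
  note P = presentationD[OF assms]
  interpret cring A by (rule presentation_cring[OF assms])
  have sub: "p ` S \<subseteq> carrier A" by (auto simp: P(1))
  interpret I: ideal "Idl\<^bsub>A\<^esub> (p ` S)" A by (rule genideal_ideal[OF sub])
  show ?thesis
  proof
    show "Idl\<^bsub>A\<^esub> (p ` S) \<subseteq> p ` idl.span (S \<union> G)"
    proof (rule genideal_minimal)
      show "ideal (p ` idl.span (S \<union> G)) A"
      proof (rule idealI)
        show "subgroup (p ` idl.span (S \<union> G)) (add_monoid A)"
        proof
          fix x assume "x \<in> p ` idl.span (S \<union> G)"
          then obtain f where f: "x = p f" "f \<in> idl.span (S \<union> G)" by blast
          then have "\<ominus>\<^bsub>A\<^esub> x = p (- f)" "- f \<in> idl.span (S \<union> G)"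
            using presentation_a_inv[OF assms] by (auto intro: idl.span_neg)
          then show "inv\<^bsub>add_monoid A\<^esub> x \<in> p ` idl.span (S \<union> G)"
            by (simp flip: a_inv_def)
        qed (auto simp: P intro!: imageI idl.span_add idl.span_zero)
      qed (auto simp: P ring_axioms idl_mult_left idl_mult_right intro!: imageI)
      show "p ` S \<subseteq> p ` idl.span (S \<union> G)"
        by (auto intro!: imageI idl.span_base)
    qed
    show "p ` idl.span (S \<union> G) \<subseteq> Idl\<^bsub>A\<^esub> (p ` S)"
    proof safe
      fix f assume "f \<in> idl.span (S \<union> G)"
      then show "p f \<in> Idl\<^bsub>A\<^esub> (p ` S)"
      proof (induction rule: idl.span_induct_alt)
        case base
        then show ?case using I.zero_closed by (simp add: P)
      next
        case (step c g f)
        have "p g \<in> Idl\<^bsub>A\<^esub> (p ` S)"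
        proof (cases "g \<in> S")
          case True
          then show ?thesis using genideal_self[OF sub] by auto
        next
          case False
          then have "p g = p 0"
            using step(1) by (simp add: presentation_eq_0[OF assms] idl.span_base)
          moreover have "p 0 \<in> Idl\<^bsub>A\<^esub> (p ` S)" using I.zero_closed by (simp add: P(6))
          ultimately show ?thesis by metis
        qed
        then have "p c \<otimes>\<^bsub>A\<^esub> p g \<oplus>\<^bsub>A\<^esub> p f \<in> Idl\<^bsub>A\<^esub> (p ` S)"
          using step by (intro I.a_closed I.I_l_closed) (auto simp: P(1))
        then show ?case by (simp add: P)
      qed
    qed
  qed
qed

text \<open>The third isomorphism theorem for presentations: relations imposed in a second step join
  those of the first.\<close>

lemma presentation_quot:
  assumes "presentation A p G"
  shows "presentation (quot_algebra A (Idl\<^bsub>A\<^esub> (p ` S))) (\<lambda>f. Idl\<^bsub>A\<^esub> (p ` S) +>\<^bsub>A\<^esub> p f) (S \<union> G)"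
proof -
  note P = presentationD[OF assms]
  interpret cring A by (rule presentation_cring[OF assms])
  have sub: "p ` S \<subseteq> carrier A" by (auto simp: P(1))
  define I where "I = Idl\<^bsub>A\<^esub> (p ` S)"
  interpret I: ideal I A unfolding I_def by (rule genideal_ideal[OF sub])
  let ?q = "\<lambda>f. I +>\<^bsub>A\<^esub> p f"
  have pc [simp]: "p f \<in> carrier A" for f by (simp add: P(1))
  have eq: "?q f = ?q g \<longleftrightarrow> f - g \<in> idl.span (S \<union> G)" for f g
  proof -
    have "?q f = ?q g \<longleftrightarrow> p f \<ominus>\<^bsub>A\<^esub> p g \<in> I"
      using quotient_eq_iff_same_a_r_cos[OF I.is_ideal pc pc] by simp
    also have "p f \<ominus>\<^bsub>A\<^esub> p g = p (f - g)"
      by (simp add: a_minus_def presentation_a_inv[OF assms] P(4))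
    also have "p (f - g) \<in> I \<longleftrightarrow> f - g \<in> idl.span (S \<union> G)"
    proof
      assume "p (f - g) \<in> I"
      then obtain h where h: "p (f - g) = p h" "h \<in> idl.span (S \<union> G)"
        by (auto simp: I_def presentation_genideal[OF assms])
      then have "f - g - h \<in> idl.span (S \<union> G)"
        using idl.span_mono[of G "S \<union> G"] by (auto simp: P(2))
      from idl.span_add[OF this h(2)] show "f - g \<in> idl.span (S \<union> G)" by simp
    qed (simp add: I_def presentation_genideal[OF assms])
    finally show ?thesis .
  qed
  \<comment> \<open>All representatives of a coset give the same scalar multiple, so the union runs
    over a constant nonempty family.\<close>
  have smult: "(\<Union>x\<in>?q f. I +>\<^bsub>A\<^esub> c \<odot>\<^bsub>A\<^esub> x) = (if c = 0 then ?q 0 else ?q f)" for c f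
  proof -
    have "I +>\<^bsub>A\<^esub> c \<odot>\<^bsub>A\<^esub> x = (if c = 0 then ?q 0 else ?q f)" if x: "x \<in> ?q f" for x
    proof -
      have "x \<in> carrier A"
        using x I.a_Hcarr by (auto simp: a_r_coset_def')
      then obtain g where g: "x = p g" by (auto simp: P(1))
      have "?q g = ?q f"
        using I.a_repr_independence'[OF x pc] g by simp
      then show ?thesis by (simp add: g P(7))
    qed
    moreover have "p f \<in> ?q f"
      by (rule I.a_rcos_self) simp
    ultimately show ?thesis by auto
  qed
  have zero: "I = ?q 0"
    using I.a_rcos_const[OF I.zero_closed] by (simp add: P(6))
  have "presentation (quot_algebra A I) ?q (S \<union> G)"
    unfolding presentation_def
  proof (intro conjI allI)
    show "carrier (quot_algebra A I) = range ?q"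
      by (auto simp: quot_algebra_def FactRing_def A_RCOSETS_def' P(1))
  next
    fix f g show "?q f = ?q g \<longleftrightarrow> f - g \<in> idl.span (S \<union> G)" by (rule eq)
  next
    fix f g show "?q f \<otimes>\<^bsub>quot_algebra A I\<^esub> ?q g = ?q (f * g)"
      by (simp add: quot_algebra_def FactRing_def I.rcoset_mult_add P(3))
  next
    fix f g show "?q f \<oplus>\<^bsub>quot_algebra A I\<^esub> ?q g = ?q (f + g)"
      by (simp add: quot_algebra_def FactRing_def I.a_rcos_sum P(4))
  next
    show "\<one>\<^bsub>quot_algebra A I\<^esub> = ?q 1"
      by (simp add: quot_algebra_def FactRing_def P(5))
  next
    show "\<zero>\<^bsub>quot_algebra A I\<^esub> = ?q 0"
      using zero by (simp add: quot_algebra_def FactRing_def)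
  next
    fix c f show "c \<odot>\<^bsub>quot_algebra A I\<^esub> ?q f = (if c = 0 then ?q 0 else ?q f)"
      using smult by (simp add: quot_algebra_def)
  qed
  then show ?thesis by (simp add: I_def)
qed

lemma presentation_steenrod_dual: "presentation steenrod_dual (\<lambda>f. f) {}"
proof -
  have "Poly_Mapping.map ((*) c) f = (if c = 0 then 0 else f)" for c and f :: steenrod
    by (rule poly_mapping_eqI) (auto simp: map.rep_eq when_def bit_not_zero_iff)
  then show ?thesis
    by (simp add: presentation_def steenrod_dual_def)
qed

lemma presentation_steenrod_trunc:
  "presentation (steenrod_trunc k) (trunc_proj k) (xi ` {k<..})"
  using presentation_quot[OF presentation_steenrod_dual, of "xi ` {k<..}"]
  by (simp add: steenrod_trunc_def trunc_proj_def[abs_def] xi_ideal_def)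

lemma set_zeta_seq: "set (zeta_seq k m) = trunc_proj k ` set (zs k m)"
  by (auto simp: zeta_seq_def zs_def)

lemma presentation_quot_zeta:
  "presentation (quot_algebra (steenrod_trunc k) (zeta_ideal k m))
     (\<lambda>f. zeta_ideal k m +>\<^bsub>steenrod_trunc k\<^esub> trunc_proj k f) (gens k m)"
  using presentation_quot[OF presentation_steenrod_trunc, of k "set (zs k m)"]
  by (simp add: zeta_ideal_def set_zeta_seq)

text \<open>The quotient by the first i entries is presented by adjoining them to G, and there the
  condition on the next entry is the one recorded in \<open>reg\<close>. Properness comes from the
  hypothesis on 1.\<close>

lemma regular_sequence_map:
  assumes P: "presentation A p G" and reg: "reg G xs" and one: "1 \<notin> idl.span (set xs \<union> G)"
  shows "regular_sequence A (map p xs)"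
  unfolding regular_sequence_def Let_def
proof (intro conjI allI impI ballI)
  show "set (map p xs) \<subseteq> carrier A"
    by (auto simp: presentationD[OF P])
  have "p 1 \<notin> Idl\<^bsub>A\<^esub> (p ` set xs)"
  proof
    assume "p 1 \<in> Idl\<^bsub>A\<^esub> (p ` set xs)"
    then obtain h where h: "1 - h \<in> idl.span G" "h \<in> idl.span (set xs \<union> G)"
      by (auto simp: presentation_genideal[OF P] presentationD(2)[OF P])
    then have "1 - h \<in> idl.span (set xs \<union> G)"
      using idl.span_mono[of G "set xs \<union> G"] by auto
    from idl.span_add[OF this h(2)] one show False by simp
  qed
  then show "Idl\<^bsub>A\<^esub> (set (map p xs)) \<noteq> carrier A"
    by (auto simp: presentationD[OF P])
next
  fix i Y
  let ?S = "set (take i xs)"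
  let ?I = "Idl\<^bsub>A\<^esub> (p ` ?S)"
  have I: "Idl\<^bsub>A\<^esub> (set (take i (map p xs))) = ?I"
    by (simp add: take_map)
  note Q = presentation_quot[OF P, of ?S]
  note QD = presentationD[OF Q]
  assume i: "i < length (map p xs)"
    and Y: "Y \<in> carrier (A Quot Idl\<^bsub>A\<^esub> (set (take i (map p xs))))"
    and eq: "(Idl\<^bsub>A\<^esub> (set (take i (map p xs))) +>\<^bsub>A\<^esub> map p xs ! i)
        \<otimes>\<^bsub>A Quot Idl\<^bsub>A\<^esub> (set (take i (map p xs)))\<^esub> Y = \<zero>\<^bsub>A Quot Idl\<^bsub>A\<^esub> (set (take i (map p xs)))\<^esub>"
  \<comment> \<open>The factor ring and \<open>quot_algebra\<close> share carrier, multiplication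
    and zero, so the presentation applies to Y.\<close>
  have "Y \<in> carrier (quot_algebra A ?I)"
    using Y by (simp only: I quot_algebra_def module.simps partial_object.simps)
  then obtain f where f: "Y = ?I +>\<^bsub>A\<^esub> p f"
    by (auto simp: QD)
  have "(?I +>\<^bsub>A\<^esub> p (xs ! i)) \<otimes>\<^bsub>quot_algebra A ?I\<^esub> Y = \<zero>\<^bsub>quot_algebra A ?I\<^esub>"
    using eq i by (simp add: I quot_algebra_def)
  then have "xs ! i * f \<in> idl.span (?S \<union> G)"
    by (simp add: f QD)
  moreover have "reg G (take i xs @ xs ! i # drop (Suc i) xs)"
    using reg i by (simp flip: id_take_nth_drop)
  then have "nonzerodiv_mod (?S \<union> G) (xs ! i)"
    by (simp add: reg_append)
  ultimately have "f \<in> idl.span (?S \<union> G)"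
    using nonzerodiv_modD by blast
  then have "Y = \<zero>\<^bsub>quot_algebra A ?I\<^esub>"
    by (simp add: f QD)
  then show "Y = \<zero>\<^bsub>A Quot Idl\<^bsub>A\<^esub> (set (take i (map p xs)))\<^esub>"
    by (simp add: I quot_algebra_def)
qed

text \<open>Deleting the monomials that contain some xi_i with i > k gives each class its unique
  representative in F_2[xi_1, ..., xi_k].\<close>

lemma trunc_proj_ring_iso: "trunc_proj k \<in> ring_iso (xi_polys k) (steenrod_trunc k)"
proof -
  note P = presentationD[OF presentation_steenrod_trunc, of k]
  let ?P = "\<lambda>\<mu>. Poly_Mapping.keys \<mu> \<subseteq> {..<k}"
  have C: "carrier (xi_polys k) = {f. \<forall>\<mu>\<in>Poly_Mapping.keys f. ?P \<mu>}"
    by (simp add: xi_polys_def)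
  have "inj_on (trunc_proj k) (carrier (xi_polys k))"
  proof (rule inj_onI)
    fix f g assume fg: "f \<in> carrier (xi_polys k)" "g \<in> carrier (xi_polys k)" "trunc_proj k f = trunc_proj k g"
    then have "restr ?P (f - g) = 0" by (simp add: P(2) xi_ideal_span_iff)
    then have "restr ?P f = restr ?P g" by (simp add: restr_diff)
    then show "f = g" using fg by (simp add: C restr_id)
  qed
  moreover have "trunc_proj k ` carrier (xi_polys k) = carrier (steenrod_trunc k)"
  proof -
    have "trunc_proj k f \<in> trunc_proj k ` carrier (xi_polys k)" for f
    proof (rule image_eqI)
      show "trunc_proj k f = trunc_proj k (restr ?P f)"
        by (simp add: P(2) xi_ideal_span_iff restr_diff restr_restr)
      show "restr ?P f \<in> carrier (xi_polys k)" by (simp add: C keys_restr)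
    qed
    then show ?thesis by (auto simp: P(1))
  qed
  moreover have "trunc_proj k \<in> Ring.ring_hom (xi_polys k) (steenrod_trunc k)"
    by (rule ring_hom_memI) (auto simp: P xi_polys_def steenrod_dual_def)
  ultimately show ?thesis by (simp add: ring_iso_def bij_betw_def)
qed

text \<open>A monomial outside the ideal involves only the finitely many xi_i outside it, each with
  exponent below its nilpotency bound.\<close>

lemma finite_nonzero_monomials:
  assumes G: "nilpotent_mod G" and fin: "finite {i. xi (Suc i) \<notin> idl.span G}"
  shows "finite {\<mu>. xmon \<mu> \<notin> idl.span G}"
proof -
  let ?A = "{i. xi (Suc i) \<notin> idl.span G}"
  have "\<forall>i. \<exists>n. xi (Suc i) ^ n \<in> idl.span G"
    using G by (simp add: nilpotent_mod_def)
  then obtain N where N: "\<And>i. xi (Suc i) ^ N i \<in> idl.span G" by metis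
  have "Poly_Mapping.lookup \<mu> i < N i" if "xmon \<mu> \<notin> idl.span G" for \<mu> i
  proof (rule ccontr)
    assume *: "\<not> ?thesis"
    have pow: "xi (Suc i) ^ n = xmon (Poly_Mapping.single i n)" for n
      by (induction n) (simp_all add: xi.simps(2) xmon_mult flip: single_add)
    have "\<mu> = (\<mu> - Poly_Mapping.single i (N i)) + Poly_Mapping.single i (N i)"
      using * by (intro poly_mapping_eqI) (auto simp: lookup_add lookup_minus lookup_single when_def)
    then have "xmon \<mu> = xmon (\<mu> - Poly_Mapping.single i (N i)) * xi (Suc i) ^ N i"
      by (simp add: xmon_mult pow)
    then show False
      using that idl_mult_left[OF N[of i]] by metis
  qed
  note bound = this
  have supp: "i \<in> ?A" if "xmon \<mu> \<notin> idl.span G" "Poly_Mapping.lookup \<mu> i \<noteq> 0" for \<mu> i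
  proof (rule CollectI, rule notI)
    assume *: "xi (Suc i) \<in> idl.span G"
    have "\<mu> = (\<mu> - Poly_Mapping.single i 1) + Poly_Mapping.single i 1"
      using that by (intro poly_mapping_eqI) (auto simp: lookup_add lookup_minus lookup_single when_def)
    then have "xmon \<mu> = xmon (\<mu> - Poly_Mapping.single i 1) * xi (Suc i)"
      by (simp add: xmon_mult xi.simps(2))
    then show False
      using that idl_mult_left[OF *] by metis
  qed
  have le: "N i \<le> (\<Sum>i\<in>?A. N i)" if "i \<in> ?A" for i
    using fin that by (intro member_le_sum) auto
  \<comment> \<open>The sum of the bounds is one common bound for all exponents, as finiteness of a
    set of functions asks for a single finite range.\<close>
  have "Poly_Mapping.lookup ` {\<mu>. xmon \<mu> \<notin> idl.span G}
      \<subseteq> {f. \<forall>i. (i \<in> ?A \<longrightarrow> f i \<in> {..\<Sum>i\<in>?A. N i}) \<and> (i \<notin> ?A \<longrightarrow> f i = 0)}"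
  proof (safe, goal_cases)
    case (1 f \<mu> i)
    then show ?case using bound[of \<mu> i] le[of i] by simp
  next
    case (2 f \<mu> i)
    then show ?case using supp[of \<mu> i] by auto
  qed
  then have "finite (Poly_Mapping.lookup ` {\<mu>. xmon \<mu> \<notin> idl.span G})"
    by (rule finite_subset) (intro finite_set_of_finite_funs fin finite_atMost)
  then show ?thesis
    by (rule finite_imageD) (simp add: inj_on_def lookup_inject)
qed

text \<open>If t were not d, the degree d component of f - w would be -w, and the homogeneous ideal
  would contain w.\<close>

lemma socle_generator_degree:
  assumes G: "homogeneous G" and w: "socle_generator G d w"
    and f: "f \<in> steenrod_grading t" "f - w \<in> idl.span G"
  shows "t = d"
proof (rule ccontr)
  assume "t \<noteq> d"
  then have "hcomp d (f - w) = - w"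
    using w hcomp_grading[of w d d] hcomp_grading[OF f(1), of d]
    by (simp add: restr_diff socle_generator_def)
  then have "w \<in> idl.span G"
    using idl.span_neg[OF hcomp_in_span[OF G f(2), of d]] by simp
  then show False using w by (simp add: socle_generator_def)
qed

text \<open>A monomial multiple of \<open>f\<close> of maximal degree outside the ideal is annihilated by every
  \<open>\<xi>\<^sub>i\<close>, hence congruent to the socle generator.\<close>

lemma socle_generator_multiple:
  assumes G: "homogeneous G" and fin: "finite {\<mu>. xmon \<mu> \<notin> idl.span G}"
    and w: "socle_generator G d w"
    and f: "f \<in> steenrod_grading t" "f \<notin> idl.span G"
  obtains \<mu> where "int (mon_degree \<mu>) = d - t" "f * xmon \<mu> - w \<in> idl.span G"
proof -
  let ?M = "{\<mu>. xmon \<mu> * f \<notin> idl.span G}"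
  have "?M \<subseteq> {\<mu>. xmon \<mu> \<notin> idl.span G}"
    using idl_mult_right by auto
  then have "finite ?M" using fin by (rule finite_subset)
  moreover have "0 \<in> ?M" using f by simp
  then have "?M \<noteq> {}" by blast
  ultimately have "Max (mon_degree ` ?M) \<in> mon_degree ` ?M"
    by (intro Max_in) auto
  then obtain \<mu> where \<mu>: "\<mu> \<in> ?M" "mon_degree \<mu> = Max (mon_degree ` ?M)" by auto
  have "xi i * (xmon \<mu> * f) \<in> idl.span G" if i: "i \<ge> 1" for i
  proof (rule ccontr)
    assume *: "\<not> ?thesis"
    let ?\<nu> = "Poly_Mapping.single (i - 1) 1 + \<mu>"
    have "?\<nu> \<in> ?M"
      using * i by (simp add: xi_eq_xmon xmon_mult flip: mult.assoc)
    then have "mon_degree ?\<nu> \<le> mon_degree \<mu>"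
      using \<open>finite ?M\<close> by (simp only: \<mu>(2)) (intro Max_ge; simp)
    moreover have "mon_degree (Poly_Mapping.single (i - 1) 1) \<noteq> 0"
      by (simp only: mon_degree_eq_0_iff flip: keys_eq_empty) simp
    ultimately show False by (simp add: mon_degree_add)
  qed
  then have "xmon \<mu> * f - w \<in> idl.span G"
    using w \<mu>(1) by (simp add: socle_generator_def annihilated_def)
  moreover have "xmon \<mu> * f \<in> steenrod_grading (int (mon_degree \<mu>) + t)"
    by (rule grading_mult[OF grading_xmon f(1)])
  ultimately have "int (mon_degree \<mu>) + t = d"
    using socle_generator_degree[OF G w] by blast
  with \<open>xmon \<mu> * f - w \<in> idl.span G\<close> show ?thesis
    by (intro that[of \<mu>]) (simp_all add: mult.commute)
qed

section \<open>The induced grading and the Frobenius property\<close>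

lemma presentation_finsum:
  assumes "presentation A p G" "finite T"
  shows "finsum A (\<lambda>t. p (f t)) T = p (\<Sum>t\<in>T. f t)"
proof -
  interpret cring A by (rule presentation_cring[OF assms(1)])
  note P = presentationD[OF assms(1)]
  show ?thesis
    using assms(2) by (induction T rule: finite_induct) (simp_all add: P(1,4,6) finsum_insert Pi_def)
qed

lemma finite_hcomps: "finite {t. hcomp t f \<noteq> 0}"
proof (rule finite_subset)
  show "{t. hcomp t f \<noteq> 0} \<subseteq> (\<lambda>\<mu>. int (mon_degree \<mu>)) ` Poly_Mapping.keys f"
    by (auto simp: restr_eq_0_iff)
qed simp

text \<open>Existence comes from the homogeneous components of f; uniqueness holds because a
  homogeneous ideal contains every component of its elements.\<close>

lemma presentation_decomposition:
  fixes A :: "(bit, 'a) module"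
  assumes P: "presentation A p G" and G: "homogeneous G"
  shows "\<exists>!c. (\<forall>t. c t \<in> p ` steenrod_grading t) \<and> finite {t. c t \<noteq> \<zero>\<^bsub>A\<^esub>} \<and>
      p f = finsum A c {t. c t \<noteq> \<zero>\<^bsub>A\<^esub>}"
proof (rule ex1I)
  note PD = presentationD[OF P]
  let ?c = "\<lambda>t. p (hcomp t f)"
  let ?T = "{t. hcomp t f \<noteq> 0}" and ?S = "{t. ?c t \<noteq> \<zero>\<^bsub>A\<^esub>}"
  have sub: "?S \<subseteq> ?T"
    by (auto simp: PD idl.span_zero)
  then have fin: "finite ?S" using finite_hcomps by (rule finite_subset)
  \<comment> \<open>A component may be nonzero as a polynomial but lie in the ideal; dropping these
    changes f only modulo the ideal.\<close>
  have "f - (\<Sum>t\<in>?S. hcomp t f) = (\<Sum>t\<in>?T. hcomp t f) - (\<Sum>t\<in>?S. hcomp t f)"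
    by (subst steenrod_sum_hcomp) (auto simp: restr_eq_0_iff finite_hcomps)
  also have "\<dots> = (\<Sum>t\<in>?T - ?S. hcomp t f)"
    by (simp add: sum.subset_diff[OF sub finite_hcomps])
  also have "\<dots> \<in> idl.span G"
    by (intro idl.span_sum) (auto simp: PD)
  finally have "p f = finsum A ?c ?S"
    by (simp add: presentation_finsum[OF P fin] PD(2))
  then show "(\<forall>t. ?c t \<in> p ` steenrod_grading t) \<and> finite ?S \<and> p f = finsum A ?c ?S"
    using fin by (auto intro: hcomp_in_grading)
  fix c :: "int \<Rightarrow> 'a"
  let ?S' = "{t. c t \<noteq> \<zero>\<^bsub>A\<^esub>}"
  assume c: "(\<forall>t. c t \<in> p ` steenrod_grading t) \<and> finite ?S' \<and> p f = finsum A c ?S'"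
  then have "\<forall>t. \<exists>g. c t = p g \<and> g \<in> steenrod_grading t" by auto
  then obtain g where g: "\<And>t. c t = p (g t)" "\<And>t. g t \<in> steenrod_grading t" by metis
  have "finsum A c ?S' = p (\<Sum>t\<in>?S'. g t)"
    using presentation_finsum[OF P, of ?S' g] c by (simp flip: g(1))
  then have *: "f - (\<Sum>t\<in>?S'. g t) \<in> idl.span G"
    using c by (simp add: PD(2))
  show "c = ?c"
  proof
    fix s
    have "hcomp s (f - (\<Sum>t\<in>?S'. g t)) = hcomp s f - (\<Sum>t\<in>?S'. if t = s then g t else 0)"
      by (simp add: restr_diff restr_sum hcomp_grading[OF g(2)])
    also have "\<dots> = hcomp s f - (if c s \<noteq> \<zero>\<^bsub>A\<^esub> then g s else 0)"
      using c by simp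
    finally have "hcomp s f - (if c s \<noteq> \<zero>\<^bsub>A\<^esub> then g s else 0) \<in> idl.span G"
      using hcomp_in_span[OF G *, of s] by simp
    then have "p (hcomp s f) = p (if c s \<noteq> \<zero>\<^bsub>A\<^esub> then g s else 0)"
      by (simp only: PD(2))
    then show "c s = ?c s"
      using g(1)[of s] by (simp add: PD(6) split: if_splits)
  qed
qed

lemma presentation_graded_algebra:
  assumes P: "presentation A p G" and G: "homogeneous G"
  shows "graded_algebra class_ring A (\<lambda>t. p ` steenrod_grading t)"
  unfolding graded_algebra_def
proof (intro conjI allI ballI)
  note PD = presentationD[OF P]
  show alg: "algebra class_ring A" by (rule presentation_algebra[OF P])
  interpret algebra "class_ring :: bit ring" A by fact
  show "VectorSpace.subspace class_ring (p ` steenrod_grading t) A" for t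
    unfolding VectorSpace.subspace_def submodule_def vectorspace_def
  proof (intro conjI allI impI)
    show "field (class_ring :: bit ring)" by (rule class_field.field_axioms)
  qed (auto simp: PD module_axioms intro!: imageI grading_add)
  show "\<one>\<^bsub>A\<^esub> \<in> p ` steenrod_grading 0"
    by (auto simp: PD grading_one)
  show "x \<otimes>\<^bsub>A\<^esub> y \<in> p ` steenrod_grading (s + t)"
    if "x \<in> p ` steenrod_grading s" "y \<in> p ` steenrod_grading t" for s t x y
    using that by (auto simp: PD intro!: imageI grading_mult)
  show "\<exists>!c. (\<forall>t. c t \<in> p ` steenrod_grading t) \<and> finite {t. c t \<noteq> \<zero>\<^bsub>A\<^esub>} \<and>
      x = finsum A c {t. c t \<noteq> \<zero>\<^bsub>A\<^esub>}" if "x \<in> carrier A" for x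
  proof -
    obtain f where "x = p f" using \<open>x \<in> carrier A\<close> by (auto simp: PD(1))
    then show ?thesis using presentation_decomposition[OF P G, of f] by simp
  qed
qed

text \<open>With coefficients in F_2, each class is the sum of a subset of the finitely many
  monomials outside the ideal.\<close>

lemma presentation_finite_carrier:
  assumes P: "presentation A p G" and fin: "finite {\<mu>. xmon \<mu> \<notin> idl.span G}"
  shows "finite (carrier A)"
proof (rule finite_subset)
  let ?M = "{\<mu>. xmon \<mu> \<notin> idl.span G}"
  show "carrier A \<subseteq> (\<lambda>F. p (\<Sum>\<mu>\<in>F. xmon \<mu>)) ` Pow ?M"
  proof
    fix x assume "x \<in> carrier A"
    then obtain f where f: "x = p f" by (auto simp: presentationD[OF P])
    let ?F = "Poly_Mapping.keys f \<inter> ?M"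
    have "f = (\<Sum>\<mu>\<in>?F. xmon \<mu>) + (\<Sum>\<mu>\<in>Poly_Mapping.keys f - ?F. xmon \<mu>)"
      by (subst steenrod_sum_xmon, subst sum.subset_diff[of ?F]) (auto simp: add.commute)
    then have "f - (\<Sum>\<mu>\<in>?F. xmon \<mu>) = (\<Sum>\<mu>\<in>Poly_Mapping.keys f - ?F. xmon \<mu>)"
      by (metis add_diff_cancel_left')
    also have "\<dots> \<in> idl.span G"
      by (intro idl.span_sum) auto
    finally have "x = p (\<Sum>\<mu>\<in>?F. xmon \<mu>)"
      by (simp add: f presentationD(2)[OF P])
    then show "x \<in> (\<lambda>F. p (\<Sum>\<mu>\<in>F. xmon \<mu>)) ` Pow ?M" by blast
  qed
  show "finite ((\<lambda>F. p (\<Sum>\<mu>\<in>F. xmon \<mu>)) ` Pow ?M)" using fin by simp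
qed

text \<open>The class of w spans the top degree, and each nonzero homogeneous class has a
  homogeneous multiple equal to it, which is nondegeneracy of the pairings.\<close>

theorem presentation_graded_frobenius:
  assumes P: "presentation A p G" and G: "homogeneous G"
    and fin: "finite {\<mu>. xmon \<mu> \<notin> idl.span G}" and w: "socle_generator G d w"
  shows "graded_frobenius_algebra class_ring A (\<lambda>t. p ` steenrod_grading t) d"
proof -
  note PD = presentationD[OF P]
  let ?gr = "\<lambda>t. p ` steenrod_grading t"
  have graded: "graded_algebra class_ring A ?gr" by (rule presentation_graded_algebra[OF P G])
  interpret algebra "class_ring :: bit ring" A by (rule presentation_algebra[OF P])
  interpret A: vectorspace "class_ring :: bit ring" A
    by (intro vectorspace.intro module_axioms class_field.field_axioms)
  have finA: "finite (carrier A)" by (rule presentation_finite_carrier[OF P fin])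
  have sub: "?gr t \<subseteq> carrier A" for t by (auto simp: PD)
  have finV: "finite (?gr t)" for t by (rule finite_subset[OF sub finA])
  have vs: "vectorspace class_ring (A\<lparr>carrier := ?gr t\<rparr>)" for t
    using graded by (intro A.subspace_is_vs) (simp add: graded_algebra_def)
  have md: "Module.module class_ring (A\<lparr>carrier := ?gr t\<rparr>)" for t
    using vs by (simp add: vectorspace_def)
  have multiple: "\<exists>g\<in>steenrod_grading (d - t). f * g - w \<in> idl.span G"
    if "f \<in> steenrod_grading t" "f \<notin> idl.span G" for f t
    using socle_generator_multiple[OF G fin w that] by (metis grading_xmon)
  have w0: "p w \<noteq> \<zero>\<^bsub>A\<^esub>" and wd: "w \<in> steenrod_grading d"
    using w by (auto simp: PD socle_generator_def)
  have above: "?gr t = {\<zero>\<^bsub>A\<^esub>}" if "t > d" for t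
  proof -
    \<comment> \<open>A multiple of f congruent to w would need a cofactor of negative degree d -
      t.\<close>
    have "f \<in> idl.span G" if f: "f \<in> steenrod_grading t" for f
    proof (rule ccontr)
      assume "f \<notin> idl.span G"
      then obtain \<mu> where "int (mon_degree \<mu>) = d - t"
        using socle_generator_multiple[OF G fin w f] by blast
      then show False using \<open>t > d\<close> by simp
    qed
    then show ?thesis by (force simp: PD intro: image_eqI[of _ _ 0])
  qed
  have top: "?gr d = {\<zero>\<^bsub>A\<^esub>, p w}"
  proof -
    \<comment> \<open>In degree d the cofactor has degree 0, so it is the monomial 1 and f itself is
      congruent to w.\<close>
    have "p f = p w" if f: "f \<in> steenrod_grading d" "f \<notin> idl.span G" for f
    proof -
      obtain \<mu> where \<mu>: "int (mon_degree \<mu>) = d - d" "f * xmon \<mu> - w \<in> idl.span G"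
        using socle_generator_multiple[OF G fin w f] by blast
      then have "\<mu> = 0" by (simp add: mon_degree_eq_0_iff)
      with \<mu>(2) show ?thesis by (simp add: PD(2))
    qed
    then show ?thesis
      using wd by (auto simp: PD intro: image_eqI[of _ _ 0])
  qed
  have "vectorspace.dim class_ring (A\<lparr>carrier := ?gr d\<rparr>) = 1"
  proof -
    interpret L: vectorspace "class_ring :: bit ring" "A\<lparr>carrier := ?gr d\<rparr>" by (rule vs)
    have "L.span {p w} \<subseteq> carrier (A\<lparr>carrier := ?gr d\<rparr>)"
      using wd by (intro L.span_is_subset2) auto
    moreover have "p w \<in> L.span {p w}"
      using wd L.in_own_span[of "{p w}"] by auto
    moreover have "\<zero>\<^bsub>A\<^esub> \<in> L.span {p w}"
      using wd L.span_is_submodule[of "{p w}"] by (auto simp: submodule_def)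
    ultimately have "L.span {p w} = carrier (A\<lparr>carrier := ?gr d\<rparr>)"
      using top by auto
    then show ?thesis
      using w0 wd by (intro L.dim1I) auto
  qed
  moreover have "vectorspace.fin_dim class_ring A"
    unfolding A.fin_dim_def
    using finA in_own_span[of "carrier A"] span_is_subset2[of "carrier A"]
    by (intro exI[of _ "carrier A"]) auto
  moreover have "perfect_pairing class_ring (A\<lparr>carrier := ?gr t\<rparr>) (A\<lparr>carrier := ?gr (d - t)\<rparr>)
      (A\<lparr>carrier := ?gr d\<rparr>) (\<lambda>x y. x \<otimes>\<^bsub>A\<^esub> y)" for t
  proof (rule f2_perfect_pairingI[OF md _ md _ md, where e = "p w"])
    \<comment> \<open>Stated for every degree s: s = t serves the left factor, and s = d - t with
      commutativity the right one.\<close>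
    have nondeg: "\<exists>y\<in>?gr (d - s). x \<otimes>\<^bsub>A\<^esub> y \<noteq> \<zero>\<^bsub>A\<^esub>" if x: "x \<in> ?gr s" "x \<noteq> \<zero>\<^bsub>A\<^esub>" for x s
    proof -
      obtain f where f: "x = p f" "f \<in> steenrod_grading s" using x by auto
      then obtain g where "g \<in> steenrod_grading (d - s)" "f * g - w \<in> idl.span G"
        using multiple x(2) by (auto simp: PD(2,6))
      moreover from this have "x \<otimes>\<^bsub>A\<^esub> p g = p w"
        by (simp add: f PD(2,3))
      ultimately show ?thesis using w0 by (intro bexI[of _ "p g"]) auto
    qed
    show "\<exists>y\<in>carrier (A\<lparr>carrier := ?gr (d - t)\<rparr>). x \<otimes>\<^bsub>A\<^esub> y \<noteq> \<zero>\<^bsub>A\<lparr>carrier := ?gr d\<rparr>\<^esub>"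
      if "x \<in> carrier (A\<lparr>carrier := ?gr t\<rparr>)" "x \<noteq> \<zero>\<^bsub>A\<lparr>carrier := ?gr t\<rparr>\<^esub>" for x
      using that nondeg[of x t] by simp
    show "\<exists>x\<in>carrier (A\<lparr>carrier := ?gr t\<rparr>). x \<otimes>\<^bsub>A\<^esub> y \<noteq> \<zero>\<^bsub>A\<lparr>carrier := ?gr d\<rparr>\<^esub>"
      if y: "y \<in> carrier (A\<lparr>carrier := ?gr (d - t)\<rparr>)" "y \<noteq> \<zero>\<^bsub>A\<lparr>carrier := ?gr (d - t)\<rparr>\<^esub>" for y
    proof -
      obtain x where x: "x \<in> ?gr (d - (d - t))" "y \<otimes>\<^bsub>A\<^esub> x \<noteq> \<zero>\<^bsub>A\<^esub>"
        using y nondeg[of y "d - t"] by auto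
      moreover have "x \<otimes>\<^bsub>A\<^esub> y = y \<otimes>\<^bsub>A\<^esub> x"
        using x y sub by (intro m_comm) auto
      ultimately show ?thesis by (intro bexI[of _ x]) auto
    qed
    show "x \<otimes>\<^bsub>A\<^esub> y \<in> carrier (A\<lparr>carrier := ?gr d\<rparr>)"
      if xy: "x \<in> carrier (A\<lparr>carrier := ?gr t\<rparr>)" "y \<in> carrier (A\<lparr>carrier := ?gr (d - t)\<rparr>)" for x y
    proof -
      obtain f g where "x = p f" "y = p g" "f \<in> steenrod_grading t" "g \<in> steenrod_grading (d - t)"
        using xy by auto
      moreover from this have "f * g \<in> steenrod_grading d"
        using grading_mult[of f t g "d - t"] by simp
      ultimately show ?thesis by (simp add: PD(3))
    qed
    show "carrier (A\<lparr>carrier := ?gr d\<rparr>) = {\<zero>\<^bsub>A\<lparr>carrier := ?gr d\<rparr>\<^esub>, p w}"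
      using top by simp
    show "x \<otimes>\<^bsub>A\<^esub> (y \<oplus>\<^bsub>A\<lparr>carrier := ?gr (d - t)\<rparr>\<^esub> y')
        = x \<otimes>\<^bsub>A\<^esub> y \<oplus>\<^bsub>A\<lparr>carrier := ?gr d\<rparr>\<^esub> x \<otimes>\<^bsub>A\<^esub> y'"
      if "x \<in> carrier (A\<lparr>carrier := ?gr t\<rparr>)" "y \<in> carrier (A\<lparr>carrier := ?gr (d - t)\<rparr>)"
        "y' \<in> carrier (A\<lparr>carrier := ?gr (d - t)\<rparr>)" for x y y'
      using that sub by (simp add: subset_iff r_distr)
    show "(x \<oplus>\<^bsub>A\<lparr>carrier := ?gr t\<rparr>\<^esub> x') \<otimes>\<^bsub>A\<^esub> y
        = x \<otimes>\<^bsub>A\<^esub> y \<oplus>\<^bsub>A\<lparr>carrier := ?gr d\<rparr>\<^esub> x' \<otimes>\<^bsub>A\<^esub> y"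
      if "x \<in> carrier (A\<lparr>carrier := ?gr t\<rparr>)" "x' \<in> carrier (A\<lparr>carrier := ?gr t\<rparr>)"
        "y \<in> carrier (A\<lparr>carrier := ?gr (d - t)\<rparr>)" for x x' y
      using that sub by (simp add: subset_iff l_distr)
  qed (simp_all add: finV w0)
  ultimately show ?thesis
    unfolding graded_frobenius_algebra_def using graded above by blast
qed

section \<open>Assembly for the truncated dual Steenrod algebra\<close>

theorem theorem1p4:
  fixes k m :: nat
  shows "trunc_proj k \<in> ring_iso (xi_polys k) (steenrod_trunc k) \<and>
    regular_sequence (steenrod_trunc k) (zeta_seq k m) \<and>
    (\<forall>i>m + k. trunc_proj k (zeta i) \<in> zeta_ideal k m) \<and>
    graded_frobenius_algebra class_ring
      (quot_algebra (steenrod_trunc k) (zeta_ideal k m))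
      (quot_grading (steenrod_trunc k) (steenrod_trunc_grading k) (zeta_ideal k m))
      (2 ^ (m + k + 1) - 2 ^ (m + 1) - 2 ^ (k + 1) + 2)"
proof (intro conjI allI impI)
  note P = presentation_steenrod_trunc[of k]
  show "trunc_proj k \<in> ring_iso (xi_polys k) (steenrod_trunc k)"
    by (rule trunc_proj_ring_iso)
  have "zeta_seq k m = map (trunc_proj k) (zs k m)"
    by (simp add: zeta_seq_def zs_def)
  then show "regular_sequence (steenrod_trunc k) (zeta_seq k m)"
    using regular_sequence_map[OF P reg_zs one_notin_span[OF homogeneous_gens]] by simp
  show "trunc_proj k (zeta i) \<in> zeta_ideal k m" if "i > m + k" for i
    using that higher_zeta_gens[of m i k]
    by (simp add: zeta_ideal_def set_zeta_seq presentation_genideal[OF P])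
  \<comment> \<open>The grading induced in two steps is the image of the grading of A_* under the
    composite projection.\<close>
  have "quot_grading (steenrod_trunc k) (steenrod_trunc_grading k) (zeta_ideal k m)
      = (\<lambda>t. (\<lambda>f. zeta_ideal k m +>\<^bsub>steenrod_trunc k\<^esub> trunc_proj k f) ` steenrod_grading t)"
    by (simp add: quot_grading_def[abs_def] steenrod_trunc_grading_def image_image trunc_proj_def)
  moreover have "finite {\<mu>. xmon \<mu> \<notin> idl.span (gens k m)}"
  proof (rule finite_nonzero_monomials[OF nilpotent_mod_gens])
    \<comment> \<open>Only xi_1, ..., xi_k can survive in the quotient; the index i stands for
      xi_{i+1}.\<close>
    have "{i. xi (Suc i) \<notin> idl.span (gens k m)} \<subseteq> {..<k}"
      by (auto simp: not_less[symmetric] intro: idl.span_base)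
    then show "finite {i. xi (Suc i) \<notin> idl.span (gens k m)}"
      by (rule finite_subset) simp
  qed
  moreover obtain w where "socle_generator (gens k m) (top_degree k m) w"
    using ex_socle_generator_gens by blast
  ultimately show "graded_frobenius_algebra class_ring
      (quot_algebra (steenrod_trunc k) (zeta_ideal k m))
      (quot_grading (steenrod_trunc k) (steenrod_trunc_grading k) (zeta_ideal k m))
      (2 ^ (m + k + 1) - 2 ^ (m + 1) - 2 ^ (k + 1) + 2)"
    using presentation_graded_frobenius[OF presentation_quot_zeta homogeneous_gens]
    by (simp only: top_degree_def)
qed

end
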